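(* Let $q$ be a prime power and let $r$ be an integer with $1<r<q+1$ and $r$ dividing $q+1$. Then there exists a genuinely nonabelian partial difference set with parameters $$\left(q^3,\ (q-1)\left(\frac{(q+1)^2}{r}-q\right),\ r\left(\frac{q+1}{r}-1\right)^3+r-3,\ \left(\frac{q+1}{r}-1\right)\left(\frac{(q+1)^2}{r}-q\right)\right).$$
   Context: Let $G$ be a finite group of order $v$. A $(v,k,\lambda,\mu)$ partial difference set (PDS) in $G$ is a subset $S\subseteq G$ with $|S|=k$, $1\notin S$, $S=\{s^{-1}:s\in S\}$, such that in the group ring $\mathbb{Z}[G]$ (identifying a subset with the sum of its elements) $S^2=k\cdot 1+\lambda S+\mu(G-S-1)$. Equivalently, the Cayley graph $\mathrm{Cay}(G,S)$ (vertex set $G$, with $x\sim y$ iff $xy^{-1}\in S$) is a strongly regular graph with parameters $(v,k,\lambda,\mu)$: it is $k$-regular on $v$ vertices, any two adjacent vertices have exactly $\lambda$ common neighbors, and any two distinct nonadjacent vertices have exactly $\mu$ common neighbors. A PDS $S$ in $G$ is called genuinely nonabelian if the automorphism group of the graph $\mathrm{Cay}(G,S)$ has no abelian subgroup acting sharply transitively (regularly) on the vertices. Standing assumption (nontriviality): $0<\mu<k$ (hence $\lambda<k-1$). *)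

theory Defs
  imports
    "HOL-Algebra.Algebra"
    "HOL-Number_Theory.Prime_Powers"
    "HOL-Library.Indicator_Function"
begin

text \<open>
  Elements of the integral group ring of a finite group \<open>G\<close> are represented by their coefficient
  functions, so that the group ring product is the convolution below.  A subset of \<open>G\<close>, regarded
  as the sum of its elements, is its \<^const>\<open>indicator\<close> function.
\<close>

definition gring_mult ::
    "('a, 'm) monoid_scheme \<Rightarrow> ('a \<Rightarrow> int) \<Rightarrow> ('a \<Rightarrow> int) \<Rightarrow> 'a \<Rightarrow> int" where
  "gring_mult G a b =
     (\<lambda>x. \<Sum>(y, z) \<in> {(y, z) \<in> carrier G \<times> carrier G. y \<otimes>\<^bsub>G\<^esub> z = x}. a y * b z)"

text \<open>
  The conjunct \<open>0 < mu \<and> mu < k\<close> is the usual nontriviality condition.  The parameters are integers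
  so that expressions for them can be written with true subtraction.
\<close>

definition partial_difference_set ::
    "('a, 'm) monoid_scheme \<Rightarrow> 'a set \<Rightarrow> int \<Rightarrow> int \<Rightarrow> int \<Rightarrow> int \<Rightarrow> bool" where
  "partial_difference_set G S v k lam mu \<longleftrightarrow>
     group G \<and> finite (carrier G) \<and> int (order G) = v \<and>
     S \<subseteq> carrier G \<and> int (card S) = k \<and> \<one>\<^bsub>G\<^esub> \<notin> S \<and> S = {inv\<^bsub>G\<^esub> s | s. s \<in> S} \<and>
     gring_mult G (indicator S) (indicator S) =
       (\<lambda>x. k * indicator {\<one>\<^bsub>G\<^esub>} x + lam * indicator S x
          + mu * (indicator (carrier G) x - indicator S x - indicator {\<one>\<^bsub>G\<^esub>} x)) \<and>
     0 < mu \<and> mu < k"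

text \<open>A graph is given by its vertex set and its adjacency relation.\<close>

definition cayley_adj :: "('a, 'm) monoid_scheme \<Rightarrow> 'a set \<Rightarrow> 'a rel" where
  "cayley_adj G S = {(x, y) \<in> carrier G \<times> carrier G. x \<otimes>\<^bsub>G\<^esub> inv\<^bsub>G\<^esub> y \<in> S}"

definition graph_Aut :: "'a set \<Rightarrow> 'a rel \<Rightarrow> ('a \<Rightarrow> 'a) monoid" where
  "graph_Aut V E = (BijGroup V)
     \<lparr>carrier := {f \<in> Bij V. \<forall>x \<in> V. \<forall>y \<in> V. (f x, f y) \<in> E \<longleftrightarrow> (x, y) \<in> E}\<rparr>"

definition sharply_transitive_on :: "('a \<Rightarrow> 'a) set \<Rightarrow> 'a set \<Rightarrow> bool" where
  "sharply_transitive_on H V \<longleftrightarrow> (\<forall>x \<in> V. \<forall>y \<in> V. \<exists>!h. h \<in> H \<and> h x = y)"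

definition genuinely_nonabelian :: "('a, 'm) monoid_scheme \<Rightarrow> 'a set \<Rightarrow> bool" where
  "genuinely_nonabelian G S \<longleftrightarrow>
     (let A = graph_Aut (carrier G) (cayley_adj G S)
      in \<not> (\<exists>H. subgroup H A \<and> comm_group (A\<lparr>carrier := H\<rparr>) \<and>
                sharply_transitive_on H (carrier G)))"

end

theory Submission
  imports Defs Complex_Main "HOL-Number_Theory.Cong"
begin

text \<open>
  Let \<open>K\<close> be the field with \<open>q\<^sup>2\<close> elements, \<open>\<sigma> x = x\<^sup>q\<close> its involution and \<open>N a = a \<sigma>(a)\<close>
  the norm.  The construction lives in the Heisenberg group of order \<open>q\<^sup>3\<close>, the set of pairs \<open>(a, b)\<close>
  with \<open>b + \<sigma>(b) + N a = 0\<close> and product \<open>(a, b) (c, d) = (a + c, b + d - a \<sigma>(c))\<close>.  It acts regularly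
  on the points of a Hermitian unital other than one fixed point.  Put \<open>m = (q + 1) / r\<close>.

  For \<open>u \<noteq> 1\<close> of norm one put \<open>w\<^sub>u = 1 / (1 - u)\<close>, an element of trace one.  The slice
  \<open>Y\<^sub>u = {(a, - N a w\<^sub>u)}\<close> is a transversal of the centre \<open>Z\<close>.  In the group ring of the
  Heisenberg group \<open>H\<close> these sets multiply almost like the norm-one group itself:
  \<open>Y\<^sub>u Y\<^sub>v = (q + 1) H - q Y\<^sub>u\<^sub>v\<close> if \<open>u v \<noteq> 1\<close> and
  \<open>Y\<^sub>u Y\<^sub>v = q\<^sup>2 + q (H - Z)\<close> if \<open>u v = 1\<close>; moreover \<open>Y\<^sub>u Z = Z Y\<^sub>u = H\<close> and \<open>Z Z = q Z\<close>.
  The first rule holds because a coefficient of \<open>Y\<^sub>u Y\<^sub>v\<close> counts, after completing a square,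
  the solutions of \<open>N z = c\<close>, of which there is one for \<open>c = 0\<close> and \<open>q + 1\<close> otherwise; and \<open>c\<close>
  vanishes exactly on \<open>Y\<^sub>u\<^sub>v\<close>.  Hence, for any group \<open>U\<close> of \<open>m\<close> elements of norm one, the span of
  \<open>1\<close>, \<open>Z\<close>, \<open>H\<close> and \<open>\<Sum>\<^bsub>u \<in> U - 1\<^esub> Y\<^sub>u\<close> contains the square of
  \<open>S = \<Sum>\<^bsub>u \<in> U - 1\<^esub> Y\<^sub>u + Z - m\<close>, and the coefficients of \<open>Z\<close> and of the slices in that square
  agree: \<open>S\<close> is a partial difference set (\<open>pds_of_multiplicative_family\<close>,
  \<open>partial_difference_set_heis\<close>).

  No abelian group acts regularly on the Cayley graph.  Let \<open>l\<close> be a prime divisor of \<open>m\<close>; it does not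
  divide \<open>q\<close>, since \<open>m\<close> divides \<open>q + 1\<close>.  The parameters satisfy \<open>k - \<mu> = - 1\<close> and
  \<open>\<lambda> - \<mu> = - 2\<close> modulo \<open>l\<close>, so \<open>T = S + 1\<close> has a square that is constant modulo \<open>l\<close>, and then so is
  \<open>T\<^sup>l\<close>.  In an abelian group \<open>T\<^sup>l\<close> is congruent to the sum of the \<open>l\<close>-th powers of the elements of \<open>T\<close>.  As \<open>l\<close> is
  prime to the order of the group, taking \<open>l\<close>-th powers is injective, and \<open>T\<close> itself would be constant
  modulo \<open>l\<close>, which means empty or the whole group (\<open>trivial_if_square_constant_mod_prime\<close>,
  \<open>pds_genuinely_nonabelian\<close>).

  The field \<open>K\<close> is obtained as a residue field of \<open>\<int>[\<zeta>]\<close>, where \<open>\<zeta>\<close> is a complex primitive root of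
  unity of order \<open>q\<^sup>2 - 1\<close>, at a maximal ideal that contains the characteristic (\<open>finite_field_exists\<close>).
\<close>

section \<open>Rings of integers modulo a maximal ideal\<close>

text \<open>
  The ring \<open>\<int>[z]\<close>, generated additively by the powers of \<open>z\<close>.  With this description every closure
  property is a short rule induction, and for a root of unity \<open>z\<close> finite generation as a group is
  visible at once.
\<close>

inductive_set int_adjoin :: "complex \<Rightarrow> complex set" for z where
  zero: "0 \<in> int_adjoin z"
| plus: "x \<in> int_adjoin z \<Longrightarrow> x + z ^ i \<in> int_adjoin z"
| minus: "x \<in> int_adjoin z \<Longrightarrow> x - z ^ i \<in> int_adjoin z"

lemma int_adjoin_add: "y \<in> int_adjoin z \<Longrightarrow> x \<in> int_adjoin z \<Longrightarrow> x + y \<in> int_adjoin z"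
  by (induction y rule: int_adjoin.induct)
     (auto simp: add.assoc[symmetric] add_diff_eq intro: int_adjoin.intros)

lemma int_adjoin_uminus: "x \<in> int_adjoin z \<Longrightarrow> - x \<in> int_adjoin z"
proof (induction x rule: int_adjoin.induct)
  case (plus x i)
  then show ?case using int_adjoin.minus[of "- x" z i] by simp
next
  case (minus x i)
  then show ?case using int_adjoin.plus[of "- x" z i] by simp
qed (simp add: int_adjoin.zero)

lemma int_adjoin_power: "z ^ i \<in> int_adjoin z"
  using int_adjoin.plus[OF int_adjoin.zero] by simp

lemma int_adjoin_mult_power: "x \<in> int_adjoin z \<Longrightarrow> x * z ^ j \<in> int_adjoin z"
  by (induction x rule: int_adjoin.induct)
     (auto simp: algebra_simps power_add[symmetric] intro: int_adjoin.intros)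

lemma int_adjoin_mult: "y \<in> int_adjoin z \<Longrightarrow> x \<in> int_adjoin z \<Longrightarrow> x * y \<in> int_adjoin z"
proof (induction y rule: int_adjoin.induct)
  case (plus y i)
  then show ?case using int_adjoin_mult_power[of x z i] int_adjoin_add by (simp add: algebra_simps)
next
  case (minus y i)
  then show ?case using int_adjoin_uminus[OF int_adjoin_mult_power[of x z i]] int_adjoin_add
    by (fastforce simp add: algebra_simps)
qed (simp add: int_adjoin.zero)

lemma int_adjoin_one: "1 \<in> int_adjoin z" using int_adjoin_power[of z 0] by simp
lemma int_adjoin_gen: "z \<in> int_adjoin z" using int_adjoin_power[of z 1] by simp
lemma int_adjoin_pow: "x \<in> int_adjoin z \<Longrightarrow> x ^ k \<in> int_adjoin z"
  by (induction k) (auto intro: int_adjoin_one int_adjoin_mult)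
lemma int_adjoin_of_nat: "of_nat k \<in> int_adjoin z"
  by (induction k) (auto intro: int_adjoin_one int_adjoin_add int_adjoin.zero)
lemma int_adjoin_sum: "(\<And>i. i \<in> I \<Longrightarrow> f i \<in> int_adjoin z) \<Longrightarrow> sum f I \<in> int_adjoin z"
  by (induction I rule: infinite_finite_induct) (auto intro: int_adjoin_add int_adjoin.zero)

text \<open>
  A \<open>\<rat>\<close>-linear functional on \<open>\<complex>\<close> bounds denominators in a finitely generated subgroup of \<open>\<complex>\<close> without
  any theory of algebraic integers.
\<close>

lemma rat_linear_functional:
  "\<exists>\<phi>::complex \<Rightarrow> rat. (\<forall>x y. \<phi> (x + y) = \<phi> x + \<phi> y) \<and> (\<forall>r x. \<phi> (of_rat r * x) = r * \<phi> x) \<and> \<phi> 1 = 1"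
proof -
  interpret V: vector_space_pair "\<lambda>(r::rat) (x::complex). of_rat r * x" "\<lambda>(r::rat) (x::rat). r * x"
    by unfold_locales (auto simp: algebra_simps of_rat_add of_rat_mult)
  have "V.vs1.independent {1}" by simp
  from V.linear_independent_extend[OF this, of "\<lambda>_. 1"]
  obtain g where "Vector_Spaces.linear (\<lambda>(r::rat) (x::complex). of_rat r * x) (\<lambda>(r::rat) (x::rat). r * x) g"
     "g 1 = 1" by auto
  then show ?thesis
    by (intro exI[of _ g]) (simp add: linear_iff_module_hom module_hom_iff)
qed

text \<open>
  Otherwise the ring would contain all powers of \<open>1 / p\<close>.  But it is generated as a group by the \<open>n\<close>
  numbers \<open>z\<^sup>i\<close> with \<open>i < n\<close>, so a rational functional that fixes \<open>1\<close> takes values with a common denominator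
  on it.
\<close>

lemma inverse_nat_notin_int_adjoin:
  assumes z: "z ^ n = 1" "n > 0" and p: "p > 1"
  shows "1 / of_nat p \<notin> int_adjoin z"
proof
  assume *: "1 / of_nat p \<in> int_adjoin z"
  obtain \<phi> :: "complex \<Rightarrow> rat" where add: "\<And>x y. \<phi> (x + y) = \<phi> x + \<phi> y"
    and scale: "\<And>r x. \<phi> (of_rat r * x) = r * \<phi> x" and one: "\<phi> 1 = 1"
    using rat_linear_functional by blast
  have diff: "\<phi> (x - y) = \<phi> x - \<phi> y" for x y
    using add[of "x - y" y] by simp
  have zpow: "z ^ i = z ^ (i mod n)" for i
    by (metis z(1) mult_div_mod_eq power_add power_mult power_one mult_1)
  define D where "D = (\<Prod>i<n. snd (quotient_of (\<phi> (z ^ i))))"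
  have "D > 0" unfolding D_def by (intro prod_pos) (auto simp: quotient_of_denom_pos')
  have Dz: "of_int D * \<phi> (z ^ i) \<in> \<int>" for i
  proof -
    let ?j = "i mod n"
    obtain a b where ab: "quotient_of (\<phi> (z ^ ?j)) = (a, b)" by force
    have "snd (quotient_of (\<phi> (z ^ ?j))) dvd D"
      unfolding D_def using z(2) by (intro dvd_prodI) auto
    then obtain c where "D = b * c" using ab by (auto simp: dvd_def)
    moreover have "\<phi> (z ^ i) = of_int a / of_int b" "b > 0"
      using quotient_of_div[OF ab] quotient_of_denom_pos[OF ab] zpow[of i] by auto
    ultimately have "of_int D * \<phi> (z ^ i) = of_int (c * a)" by simp
    then show ?thesis by (metis Ints_of_int)
  qed
  have zero: "\<phi> 0 = 0" using add[of 0 0] by simp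
  have int: "of_int D * \<phi> x \<in> \<int>" if "x \<in> int_adjoin z" for x
    using that by induction (auto simp: zero add diff distrib_left right_diff_distrib Dz)
  have pw: "\<phi> ((1 / of_nat p) ^ j) = 1 / of_nat p ^ j" for j
    using scale[of "(1 / of_nat p) ^ j" 1] one
    by (simp add: of_rat_power of_rat_divide power_divide)
  define j where "j = nat D"
  have "of_int D * \<phi> ((1 / of_nat p) ^ j) \<in> \<int>" by (intro int int_adjoin_pow *)
  then obtain k where k: "of_int D * (1 / of_nat p ^ j :: rat) = of_int k"
    unfolding pw by (auto elim: Ints_cases)
  have "of_int D = (of_int (k * int p ^ j) :: rat)" using k p by (simp add: field_simps)
  then have Dk: "D = k * int p ^ j" by (simp only: of_int_eq_iff)
  \<comment> \<open>The exponent \<open>j = D\<close> makes \<open>p\<^sup>j\<close> exceed the common denominator \<open>D\<close>.\<close>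
  have "j < 2 ^ j" by (rule less_exp)
  also have "\<dots> \<le> p ^ j" using p by (intro power_mono) auto
  finally have "j < p ^ j" .
  then have "D < int p ^ j" using \<open>D > 0\<close> unfolding j_def by (metis int_nat_eq of_nat_less_iff of_nat_power order_less_imp_le)
  moreover have "k > 0" using Dk \<open>D > 0\<close> p by (simp add: zero_less_mult_iff)
  then have "int p ^ j \<le> D" using Dk p by simp
  ultimately show False by simp
qed

definition int_adjoin_ring :: "complex \<Rightarrow> complex ring" where
  "int_adjoin_ring z = \<lparr>carrier = int_adjoin z, monoid.mult = (*), one = 1, ring.zero = 0, ring.add = (+)\<rparr>"

lemma int_adjoin_ring_simps [simp]:
  "carrier (int_adjoin_ring z) = int_adjoin z" "x \<otimes>\<^bsub>int_adjoin_ring z\<^esub> y = x * y"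
  "\<one>\<^bsub>int_adjoin_ring z\<^esub> = 1" "\<zero>\<^bsub>int_adjoin_ring z\<^esub> = 0" "x \<oplus>\<^bsub>int_adjoin_ring z\<^esub> y = x + y"
  by (simp_all add: int_adjoin_ring_def)

lemma cring_int_adjoin_ring: "cring (int_adjoin_ring z)"
proof (rule cringI)
  show "abelian_group (int_adjoin_ring z)"
    by (rule abelian_groupI)
       (auto simp: algebra_simps intro: int_adjoin_add int_adjoin.zero
         intro!: bexI[OF _ int_adjoin_uminus])
  show "comm_monoid (int_adjoin_ring z)"
    by (rule comm_monoidI) (auto simp: algebra_simps intro: int_adjoin_mult int_adjoin_one)
qed (simp add: algebra_simps)

lemma int_adjoin_ring_pow [simp]: "x [^]\<^bsub>int_adjoin_ring z\<^esub> (k::nat) = x ^ k"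
proof -
  interpret cring "int_adjoin_ring z" by (rule cring_int_adjoin_ring)
  show ?thesis by (induction k) auto
qed

text \<open>
  By Zorn's lemma, once the ideal generated by \<open>p\<close> is known to be proper, which is the statement that
  \<open>1 / p\<close> is not in the ring.
\<close>

lemma maximal_ideal_above_prime:
  assumes z: "z ^ n = 1" "n > 0" and p: "p > 1"
  shows "\<exists>M. maximalideal M (int_adjoin_ring z) \<and> of_nat p \<in> M"
proof -
  define E where "E = int_adjoin_ring z"
  interpret cring E unfolding E_def by (rule cring_int_adjoin_ring)
  define C where "C = {I. ideal I E \<and> of_nat p \<in> I \<and> 1 \<notin> I}"
  have pE: "of_nat p \<in> carrier E" by (simp add: E_def int_adjoin_of_nat)
  have "1 \<notin> PIdl\<^bsub>E\<^esub> (of_nat p)"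
  proof
    assume "1 \<in> PIdl\<^bsub>E\<^esub> (of_nat p)"
    then obtain x where x: "x \<in> int_adjoin z" "1 = x * of_nat p" by (auto simp: cgenideal_def E_def)
    from x(2) p have "x = 1 / of_nat p" by (simp add: field_simps)
    with x(1) inverse_nat_notin_int_adjoin[OF z p] show False by simp
  qed
  then have "PIdl\<^bsub>E\<^esub> (of_nat p) \<in> C"
    using cgenideal_ideal[OF pE] cgenideal_self[OF pE] by (simp add: C_def)
  then have ne: "C \<noteq> {}" by auto
  have "\<Union>D \<in> C" if D: "D \<noteq> {}" "subset.chain C D" for D
  proof -
    have "subset.chain {I. ideal I E} D"
      using D(2) by (auto simp: C_def subset.chain_def)
    from chain_Union_is_ideal[OF this] D(1) have "ideal (\<Union>D) E" by simp
    with D show ?thesis by (auto simp: C_def subset.chain_def)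
  qed
  from subset_Zorn_nonempty[OF ne this] obtain M where M: "M \<in> C"
    and max: "\<And>N. N \<in> C \<Longrightarrow> M \<subseteq> N \<Longrightarrow> N = M" by blast
  have "maximalideal M E"
  proof (rule maximalidealI)
    show "ideal M E" using M by (simp add: C_def)
    show "carrier E \<noteq> M" using M int_adjoin_one by (auto simp: C_def E_def)
    fix J assume J: "ideal J E" "M \<subseteq> J" "J \<subseteq> carrier E"
    show "J = M \<or> J = carrier E"
    proof (cases "1 \<in> J")
      case True
      then show ?thesis using ideal.one_imp_carrier[OF J(1)] by (simp add: E_def)
    next
      case False
      then have "J \<in> C" using J M by (auto simp: C_def)
      then show ?thesis using max J by blast
    qed
  qed
  then show ?thesis using M by (auto simp: C_def E_def)
qed

lemma int_adjoin_freshmans_dream: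
  assumes p: "normalization_semidom_class.prime p" and x: "x \<in> int_adjoin z" and y: "y \<in> int_adjoin z"
  shows "\<exists>w\<in>int_adjoin z. (x + y) ^ p = x ^ p + y ^ p + of_nat p * w"
proof -
  have p0: "p > 0" using p by (simp add: prime_gt_0_nat)
  define w where "w = (\<Sum>k\<in>{1..<p}. of_nat ((p choose k) div p) * x ^ k * y ^ (p - k))"
  have "{..p} = insert 0 (insert p {1..<p})" using p0 by auto
  then have "(x + y) ^ p = y ^ p + x ^ p + (\<Sum>k\<in>{1..<p}. of_nat (p choose k) * x ^ k * y ^ (p - k))"
    using p0 by (simp add: binomial_ring)
  also have "(\<Sum>k\<in>{1..<p}. of_nat (p choose k) * x ^ k * y ^ (p - k)) = of_nat p * w"
    unfolding w_def sum_distrib_left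
  proof (rule sum.cong[OF refl])
    fix k assume k: "k \<in> {1..<p}"
    then have "p dvd (p choose k)" using p by (intro dvd_choose_prime) auto
    then have "of_nat (p choose k) = (of_nat p * of_nat ((p choose k) div p) :: complex)"
      by (metis dvd_mult_div_cancel of_nat_mult)
    then show "of_nat (p choose k) * x ^ k * y ^ (p - k) =
      of_nat p * (of_nat ((p choose k) div p) * x ^ k * y ^ (p - k))" by simp
  qed
  finally show ?thesis
    by (intro bexI[of _ w]) (auto simp: w_def intro!: int_adjoin_sum int_adjoin_mult int_adjoin_of_nat int_adjoin_pow x y)
qed

lemma int_adjoin_as_sum:
  assumes z: "z ^ n = 1" "n > 0" and x: "x \<in> int_adjoin z"
  shows "\<exists>c. x = (\<Sum>i<n. of_int (c i) * z ^ i)"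
proof -
  have zpow: "z ^ i = z ^ (i mod n)" for i
    by (metis z(1) mult_div_mod_eq power_add power_mult power_one mult_1)
  have *: "(\<Sum>i<n. of_int ((c(j mod n := c (j mod n) + e)) i) * z ^ i) =
     (\<Sum>i<n. of_int (c i) * z ^ i) + of_int e * z ^ j" for c j e
  proof -
    have "j mod n \<in> {..<n}" using z by simp
    then show ?thesis
      by (simp add: sum.remove[of "{..<n}" "j mod n"] zpow[of j] algebra_simps)
  qed
  show ?thesis using x
  proof induction
    case zero
    show ?case by (rule exI[of _ "\<lambda>_. 0"]) simp
  next
    case (plus x i)
    then obtain c where "x = (\<Sum>i<n. of_int (c i) * z ^ i)" by blast
    then show ?case using *[of c i 1] by (intro exI[of _ "c(i mod n := c (i mod n) + 1)"]) simp
  next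
    case (minus x i)
    then obtain c where "x = (\<Sum>i<n. of_int (c i) * z ^ i)" by blast
    then show ?case using *[of c i "-1"] by (intro exI[of _ "c(i mod n := c (i mod n) + - 1)"]) simp
  qed
qed

section \<open>Finite fields of prime power order\<close>

text \<open>
  Let \<open>n = p\<^sup>N - 1\<close> and let \<open>\<zeta>\<close> be a primitive \<open>n\<close>-th root of unity.  In a residue field of
  \<open>\<int>[\<zeta>]\<close> of characteristic \<open>p\<close> the map \<open>x \<mapsto> x\<^sup>Q\<close> with \<open>Q = p\<^sup>N\<close> is additive and fixes the image of \<open>\<zeta>\<close>,
  hence everything; so there are at most \<open>Q\<close> elements.  Conversely the image of \<open>\<zeta>\<close> still has order \<open>n\<close>: if
  \<open>\<zeta>\<^sup>i = 1\<close> in the residue field for some \<open>0 < i < n\<close>, the vanishing sum of all \<open>\<zeta>\<^bsup>i j\<^esup>\<close> with \<open>j < n\<close> would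
  become \<open>n = - 1\<close>.  The additivity of the powers of Frobenius is recorded because, when \<open>Q = q\<^sup>2\<close>, it
  makes \<open>x \<mapsto> x\<^bsup>q\<^esup>\<close> an involutive automorphism.
\<close>

theorem finite_field_exists:
  assumes p: "normalization_semidom_class.prime p" and N: "N > 0"
  shows "\<exists>K :: complex set ring. field K \<and> finite (carrier K) \<and> order K = p ^ N \<and>
    (\<forall>j. \<forall>x\<in>carrier K. \<forall>y\<in>carrier K.
       (x \<oplus>\<^bsub>K\<^esub> y) [^]\<^bsub>K\<^esub> (p ^ j) = x [^]\<^bsub>K\<^esub> (p ^ j) \<oplus>\<^bsub>K\<^esub> y [^]\<^bsub>K\<^esub> (p ^ j))"
proof -
  have p1: "p > 1" using p by (rule prime_gt_1_nat)
  define Q where "Q = p ^ N"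
  define n where "n = Q - 1"
  have Q: "Q > 1" unfolding Q_def by (rule one_less_power[OF p1 N])
  have n: "n > 0" "Suc n = Q" using Q by (auto simp: n_def)
  define z where "z = cis (2 * pi / real n)"
  have zi: "z ^ i = cis (2 * pi * real i / real n)" for i by (simp add: z_def DeMoivre mult_ac)
  have zn: "z ^ n = 1" using n by (simp add: zi)
  have zi1: "z ^ i \<noteq> 1" if "0 < i" "i < n" for i
    using inj_onD[OF bij_betw_imp_inj_on[OF bij_betw_roots_unity[of n]], of i 0] that n by (auto simp: zi)
  define E where "E = int_adjoin_ring z"
  obtain M where M: "maximalideal M E" "of_nat p \<in> M"
    using maximal_ideal_above_prime[OF zn n(1) p1] unfolding E_def by blast
  interpret E: cring E unfolding E_def by (rule cring_int_adjoin_ring)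
  have Esimps: "carrier E = int_adjoin z" "\<And>x y. x \<otimes>\<^bsub>E\<^esub> y = x * y"
     "\<And>x y. x \<oplus>\<^bsub>E\<^esub> y = x + y" "\<zero>\<^bsub>E\<^esub> = 0" "\<one>\<^bsub>E\<^esub> = 1" "\<And>x k. x [^]\<^bsub>E\<^esub> (k::nat) = x ^ k"
    by (simp_all add: E_def)
  interpret M: maximalideal M E by (rule M)
  define K where "K = E Quot M"
  define \<phi> where "\<phi> = (\<lambda>x. M +>\<^bsub>E\<^esub> x)"
  interpret K: field K unfolding K_def by (rule M.quotient_is_field[OF E.is_cring])
  interpret h: ring_hom_ring E K \<phi>
    unfolding K_def \<phi>_def by (rule M.rcos_ring_hom_ring)
  have carK: "carrier K = \<phi> ` int_adjoin z"
    unfolding K_def \<phi>_def by (auto simp: FactRing_def A_RCOSETS_def' Esimps)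
  have Msub: "x \<in> int_adjoin z" if "x \<in> M" for x using M.a_subset that by (auto simp: Esimps)
  have \<phi>0: "\<phi> x = \<zero>\<^bsub>K\<^esub> \<longleftrightarrow> x \<in> M" if "x \<in> int_adjoin z" for x
    unfolding K_def \<phi>_def using that M.a_rcos_const[of x] M.rcos_const_imp_mem[of x]
    by (auto simp: FactRing_def Esimps)
  have add: "\<phi> (x + y) = \<phi> x \<oplus>\<^bsub>K\<^esub> \<phi> y" if "x \<in> int_adjoin z" "y \<in> int_adjoin z" for x y
    using h.hom_add[of x y] that by (simp add: Esimps)
  have mult: "\<phi> (x * y) = \<phi> x \<otimes>\<^bsub>K\<^esub> \<phi> y" if "x \<in> int_adjoin z" "y \<in> int_adjoin z" for x y
    using h.hom_mult[of x y] that by (simp add: Esimps)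
  have pow: "\<phi> (x ^ k) = \<phi> x [^]\<^bsub>K\<^esub> k" if "x \<in> int_adjoin z" for x k
    using h.hom_nat_pow[of x k] that by (simp add: Esimps)
  have [simp]: "\<phi> x \<in> carrier K" if "x \<in> int_adjoin z" for x using that carK by auto
  have \<phi>p: "\<phi> (x + of_nat p * w) = \<phi> x" if "x \<in> int_adjoin z" "w \<in> int_adjoin z" for x w
    using that add[of x "of_nat p * w"] mult[of "of_nat p" w] \<phi>0[of "of_nat p"] M(2)
    by (simp add: int_adjoin_mult int_adjoin_of_nat)
  have frob1: "(x \<oplus>\<^bsub>K\<^esub> y) [^]\<^bsub>K\<^esub> p = x [^]\<^bsub>K\<^esub> p \<oplus>\<^bsub>K\<^esub> y [^]\<^bsub>K\<^esub> p"
    if xy: "x \<in> carrier K" "y \<in> carrier K" for x y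
  proof -
    obtain a b where ab: "a \<in> int_adjoin z" "b \<in> int_adjoin z" "x = \<phi> a" "y = \<phi> b"
      using xy carK by auto
    obtain w where w: "w \<in> int_adjoin z" "(a + b) ^ p = a ^ p + b ^ p + of_nat p * w"
      using int_adjoin_freshmans_dream[OF p ab(1,2)] by blast
    have "\<phi> ((a + b) ^ p) = \<phi> (a ^ p + b ^ p)"
      unfolding w(2) by (intro \<phi>p int_adjoin_add int_adjoin_pow w ab)
    then show ?thesis
      using ab by (simp add: pow add int_adjoin_add int_adjoin_pow)
  qed
  have frob: "(x \<oplus>\<^bsub>K\<^esub> y) [^]\<^bsub>K\<^esub> (p ^ j) = x [^]\<^bsub>K\<^esub> (p ^ j) \<oplus>\<^bsub>K\<^esub> y [^]\<^bsub>K\<^esub> (p ^ j)"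
    if xy: "x \<in> carrier K" "y \<in> carrier K" for x y j
  proof (induction j)
    case (Suc j)
    have *: "u [^]\<^bsub>K\<^esub> (p ^ Suc j) = (u [^]\<^bsub>K\<^esub> (p ^ j)) [^]\<^bsub>K\<^esub> p" if "u \<in> carrier K" for u
      using that by (simp add: K.nat_pow_pow mult.commute)
    show ?case using xy by (simp add: * Suc frob1 del: power_Suc)
  qed (use xy in simp)
  have zQ: "z ^ Q = z" using zn n(2) by (metis power_Suc mult_1_right)
  have ziQ: "\<phi> (z ^ i) [^]\<^bsub>K\<^esub> Q = \<phi> (z ^ i)" for i
    by (metis int_adjoin_power pow power_mult mult.commute zQ)
  have Kpow: "\<phi> x [^]\<^bsub>K\<^esub> Q = \<phi> x" if "x \<in> int_adjoin z" for x
    using that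
  proof induction
    case zero
    then show ?case using Q pow[OF int_adjoin.zero, of Q] by (simp add: power_0_left)
  next
    case (plus x i)
    then show ?case
      using frob[of "\<phi> x" "\<phi> (z ^ i)" N] by (simp add: add int_adjoin_power ziQ flip: Q_def)
  next
    case (minus x i)
    have y: "x - z ^ i \<in> int_adjoin z" using minus by (simp add: int_adjoin.minus)
    have "\<phi> (x - z ^ i) \<oplus>\<^bsub>K\<^esub> \<phi> (z ^ i) = \<phi> x" using add[OF y int_adjoin_power[of z i]] by simp
    then have "\<phi> (x - z ^ i) [^]\<^bsub>K\<^esub> Q \<oplus>\<^bsub>K\<^esub> \<phi> (z ^ i) = \<phi> (x - z ^ i) \<oplus>\<^bsub>K\<^esub> \<phi> (z ^ i)"
      using frob[of "\<phi> (x - z ^ i)" "\<phi> (z ^ i)" N] y minus by (simp add: int_adjoin_power ziQ flip: Q_def)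
    then show ?case using y by (simp add: int_adjoin_power)
  qed
  have Kn: "x [^]\<^bsub>K\<^esub> n = \<one>\<^bsub>K\<^esub>" if "x \<in> carrier K" "x \<noteq> \<zero>\<^bsub>K\<^esub>" for x
  proof -
    have "x [^]\<^bsub>K\<^esub> Suc n = x" using Kpow that carK n(2) by auto
    then have "x [^]\<^bsub>K\<^esub> n \<otimes>\<^bsub>K\<^esub> x = \<one>\<^bsub>K\<^esub> \<otimes>\<^bsub>K\<^esub> x" using that by simp
    then show ?thesis using that K.m_rcancel[of x "x [^]\<^bsub>K\<^esub> n" "\<one>\<^bsub>K\<^esub>"] by (simp del: K.l_one)
  qed
  have fin: "finite (carrier K)"
  proof -
    \<comment> \<open>Reducing the coefficients modulo \<open>p\<close> leaves finitely many representatives.\<close>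
    define F where "F = PiE {..<n} (\<lambda>_. {..<p})"
    have "carrier K \<subseteq> (\<lambda>c. \<phi> (\<Sum>i<n. of_nat (c i) * z ^ i)) ` F"
    proof
      fix u assume "u \<in> carrier K"
      then obtain x where x: "x \<in> int_adjoin z" "u = \<phi> x" using carK by auto
      obtain c where c: "x = (\<Sum>i<n. of_int (c i) * z ^ i)" using int_adjoin_as_sum[OF zn n(1) x(1)] by blast
      define d where "d = (\<lambda>i\<in>{..<n}. nat (c i mod int p))"
      define w where "w = (\<Sum>i<n. of_int (c i div int p) * z ^ i)"
      have ofint: "of_int k \<in> int_adjoin z" for k
        by (cases k) (simp_all only: of_int_of_nat_eq of_int_minus int_adjoin_of_nat int_adjoin_uminus)
      have w: "w \<in> int_adjoin z" unfolding w_def by (intro int_adjoin_sum int_adjoin_mult int_adjoin_power ofint)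
      have s: "(\<Sum>i<n. of_nat (d i) * z ^ i) \<in> int_adjoin z"
        by (intro int_adjoin_sum int_adjoin_mult int_adjoin_power int_adjoin_of_nat)
      have "of_int (c i) = of_nat (d i) + of_nat p * (of_int (c i div int p) :: complex)" if "i < n" for i
      proof -
        have "c i = int (d i) + int p * (c i div int p)" using that p1 by (simp add: d_def)
        then show ?thesis by (metis of_int_add of_int_mult of_int_of_nat_eq)
      qed
      then have "x = (\<Sum>i<n. of_nat (d i) * z ^ i) + of_nat p * w"
        unfolding c w_def sum_distrib_left sum.distrib[symmetric]
        by (intro sum.cong refl) (simp add: distrib_right mult.assoc)
      then have "u = \<phi> (\<Sum>i<n. of_nat (d i) * z ^ i)" using \<phi>p[OF s w] x by simp
      moreover have "d \<in> F" using p1 by (auto simp: F_def d_def nat_less_iff)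
      ultimately show "u \<in> (\<lambda>c. \<phi> (\<Sum>i<n. of_nat (c i) * z ^ i)) ` F" by blast
    qed
    moreover have "finite F" unfolding F_def by (intro finite_PiE) auto
    ultimately show ?thesis by (meson finite_imageI finite_subset)
  qed
  have "carrier K \<subseteq> insert \<zero>\<^bsub>K\<^esub> {x \<in> carrier K. x [^]\<^bsub>K\<^esub> n = \<one>\<^bsub>K\<^esub>}" using Kn by auto
  then have "card (carrier K) \<le> card (insert \<zero>\<^bsub>K\<^esub> {x \<in> carrier K. x [^]\<^bsub>K\<^esub> n = \<one>\<^bsub>K\<^esub>})"
    using fin by (intro card_mono) auto
  also have "\<dots> \<le> Suc (card {x \<in> carrier K. x [^]\<^bsub>K\<^esub> n = \<one>\<^bsub>K\<^esub>})"
    using fin by (simp add: card_insert_if)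
  also have "\<dots> \<le> Q" using K.num_roots_le_deg[OF fin, of n] n by simp
  finally have upper: "card (carrier K) \<le> Q" .
  define Z where "Z = \<phi> z"
  have zE: "z \<in> int_adjoin z" by (rule int_adjoin_gen)
  have Z: "Z \<in> carrier K" using zE by (simp add: Z_def)
  have "\<phi> 1 = \<one>\<^bsub>K\<^esub>" using h.hom_one by (simp add: Esimps)
  then have Zn: "Z [^]\<^bsub>K\<^esub> n = \<one>\<^bsub>K\<^esub>" using pow[OF zE, of n] zn by (simp add: Z_def)
  have Zi: "Z [^]\<^bsub>K\<^esub> i \<noteq> \<one>\<^bsub>K\<^esub>" if i: "0 < i" "i < n" for i
  proof
    assume "Z [^]\<^bsub>K\<^esub> i = \<one>\<^bsub>K\<^esub>"
    have m1: "- 1 \<in> int_adjoin z" by (intro int_adjoin_uminus int_adjoin_one)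
    have "\<phi> (z ^ (i * j) + - 1) = \<zero>\<^bsub>K\<^esub>" for j
    proof -
      have "\<phi> (z ^ (i * j)) = \<one>\<^bsub>K\<^esub>"
        using \<open>Z [^]\<^bsub>K\<^esub> i = \<one>\<^bsub>K\<^esub>\<close> K.nat_pow_pow[OF Z, of i j]
        by (simp add: pow[OF zE] flip: Z_def)
      then have "\<phi> (z ^ (i * j) + - 1) = \<phi> 1 \<oplus>\<^bsub>K\<^esub> \<phi> (- 1)"
        using add[OF int_adjoin_power m1] \<open>\<phi> 1 = \<one>\<^bsub>K\<^esub>\<close> by simp
      also have "\<dots> = \<phi> 0" using add[OF int_adjoin_one m1] by simp
      also have "\<dots> = \<zero>\<^bsub>K\<^esub>" using h.hom_zero by (simp add: Esimps)
      finally show ?thesis .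
    qed
    then have "z ^ (i * j) + - 1 \<in> M" for j
      using \<phi>0[of "z ^ (i * j) + - 1"] int_adjoin_add[OF m1 int_adjoin_power] by blast
    then have inM: "z ^ (i * j) - 1 \<in> M" for j by simp
    \<comment> \<open>The complex numbers \<open>\<zeta>\<^bsup>i j\<^esup>\<close> with \<open>j < n\<close> sum to zero, while all of them are \<open>1\<close> modulo the ideal.\<close>
    have sumM: "(\<Sum>j<k. z ^ (i * j) - 1) \<in> M" for k
    proof (induction k)
      case 0
      then show ?case using M.a_Hcarr M.zero_closed by (simp add: Esimps)
    next
      case (Suc k)
      then show ?case using M.a_closed[OF Suc inM[of k]] by (simp add: Esimps)
    qed
    have "(\<Sum>j<n. z ^ (i * j)) = (\<Sum>j<n. (z ^ i) ^ j)" by (simp add: power_mult)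
    also have "\<dots> = ((z ^ i) ^ n - 1) / (z ^ i - 1)" using zi1[OF i] by (rule geometric_sum)
    also have "(z ^ i) ^ n = 1" by (metis zn power_mult mult.commute power_one)
    finally have "(\<Sum>j<n. z ^ (i * j)) = 0" by simp
    then have "- of_nat n \<in> M" using sumM[of n] by (simp add: sum_subtractf)
    moreover have "of_nat p * of_nat (p ^ (N - 1)) \<in> M"
      using M.I_r_closed[OF M(2), of "of_nat (p ^ (N - 1))"] int_adjoin_of_nat[of "p ^ (N - 1)" z] by (simp add: Esimps)
    ultimately have "of_nat p * of_nat (p ^ (N - 1)) + - of_nat n \<in> M"
      using M.a_closed by (metis Esimps(3))
    \<comment> \<open>Both \<open>p\<^sup>N = n + 1\<close> and \<open>n\<close> lie in the ideal, hence so does \<open>1\<close>.\<close>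
    moreover have "p * p ^ (N - 1) = Suc n" using n(2) N unfolding Q_def by (cases N) auto
    then have "of_nat p * of_nat (p ^ (N - 1)) = (of_nat (Suc n) :: complex)" by (metis of_nat_mult)
    ultimately have "1 \<in> M" by simp
    then have "carrier E = M" using M.one_imp_carrier by (simp add: Esimps)
    then show False using M.I_notcarr by simp
  qed
  have Z0: "Z [^]\<^bsub>K\<^esub> i \<noteq> \<zero>\<^bsub>K\<^esub>" for i :: nat
  proof
    assume "Z [^]\<^bsub>K\<^esub> i = \<zero>\<^bsub>K\<^esub>"
    then have "Z [^]\<^bsub>K\<^esub> (i * n) = \<zero>\<^bsub>K\<^esub>" using n Z K.nat_pow_pow[OF Z, of i n] by (simp add: K.nat_pow_zero)
    moreover have "Z [^]\<^bsub>K\<^esub> (i * n) = \<one>\<^bsub>K\<^esub>"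
      using Zn K.nat_pow_pow[OF Z, of n i] by (simp add: mult.commute)
    ultimately show False by simp
  qed
  have ne: "Z [^]\<^bsub>K\<^esub> i \<noteq> Z [^]\<^bsub>K\<^esub> j" if "i < j" "j < n" for i j
  proof
    assume "Z [^]\<^bsub>K\<^esub> i = Z [^]\<^bsub>K\<^esub> j"
    also have "\<dots> = Z [^]\<^bsub>K\<^esub> i \<otimes>\<^bsub>K\<^esub> Z [^]\<^bsub>K\<^esub> (j - i)" using that Z by (simp add: K.nat_pow_mult)
    finally have "Z [^]\<^bsub>K\<^esub> i \<otimes>\<^bsub>K\<^esub> Z [^]\<^bsub>K\<^esub> (j - i) = Z [^]\<^bsub>K\<^esub> i \<otimes>\<^bsub>K\<^esub> \<one>\<^bsub>K\<^esub>" using Z by simp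
    then have "Z [^]\<^bsub>K\<^esub> (j - i) = \<one>\<^bsub>K\<^esub>" using Z Z0[of i] by (subst (asm) K.m_lcancel) auto
    then show False using Zi[of "j - i"] that by simp
  qed
  have inj: "inj_on (\<lambda>i. Z [^]\<^bsub>K\<^esub> i) {..<n}"
    by (rule linorder_inj_onI) (use ne in auto)
  have "Suc n = card (insert \<zero>\<^bsub>K\<^esub> ((\<lambda>i. Z [^]\<^bsub>K\<^esub> i) ` {..<n}))"
    using inj Z0[symmetric] by (auto simp: card_insert_if card_image)
  also have "\<dots> \<le> card (carrier K)" using fin Z by (intro card_mono) auto
  finally have "order K = Q" using upper n by (simp add: order_def)
  then show ?thesis using K.field_axioms fin frob unfolding Q_def by (intro exI[of _ K]) blast
qed

section \<open>Prime powers in the group ring of an abelian group\<close>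

lemma rotate_orbit_eq:
  assumes "length x = n" "n > 0"
  shows "(\<lambda>i. rotate i x) ` {..<n} = range (\<lambda>i. rotate i x)"
proof -
  have "rotate i x \<in> (\<lambda>i. rotate i x) ` {..<n}" for i
    using assms rotate_conv_mod[of i x] by (intro image_eqI[of _ _ "i mod n"]) auto
  then show ?thesis by auto
qed

lemma card_rotate_orbit:
  assumes l: "normalization_semidom_class.prime (length x)" and ne: "rotate1 x \<noteq> x"
  shows "card ((\<lambda>i. rotate i x) ` {..<length x}) = length x"
proof -
  let ?l = "length x"
  have "rotate i x \<noteq> rotate j x" if "i < j" "j < ?l" for i j
  proof
    assume eq: "rotate i x = rotate j x"
    define d where "d = j - i"
    have "rotate (?l - i) (rotate i x) = rotate (?l - i) (rotate j x)" by (simp add: eq)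
    then have "rotate ?l x = rotate (?l + d) x" using that by (simp add: rotate_rotate d_def)
    then have "rotate d x = x" using rotate_conv_mod[of "?l + d" x] rotate_conv_mod[of d x] by simp
    have d: "rotate (d * k) x = x" for k
      by (induction k) (use \<open>rotate d x = x\<close> in \<open>simp_all flip: rotate_rotate\<close>)
    have "coprime d ?l"
      using prime_imp_coprime[OF l, of d] that nat_dvd_not_less[of d ?l]
      by (auto simp: d_def coprime_commute)
    \<comment> \<open>Since \<open>d\<close> is invertible modulo the prime length, rotation by \<open>d\<close> generates rotation by one.\<close>
    then obtain k where "[d * k = Suc 0] (mod ?l)" using cong_solve_coprime_nat by blast
    then have "rotate (d * k) x = rotate 1 x"
      using rotate_conv_mod[of "d * k" x] rotate_conv_mod[of 1 x] by (simp add: cong_def)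
    then show False using d ne by simp
  qed
  then have "inj_on (\<lambda>i. rotate i x) {..<?l}" by (intro linorder_inj_onI) auto
  then show ?thesis by (simp add: card_image)
qed

text \<open>
  Rotation generates an action of the cyclic group of prime order \<open>l\<close>, whose orbits have \<open>1\<close> or \<open>l\<close>
  elements.
\<close>

lemma card_mod_prime_rotate_fixed:
  assumes l: "normalization_semidom_class.prime l" and F: "finite F" "\<And>x. x \<in> F \<Longrightarrow> length x = l"
    and closed: "\<And>x. x \<in> F \<Longrightarrow> rotate1 x \<in> F"
  shows "[card F = card {x \<in> F. rotate1 x = x}] (mod l)"
proof -
  define Y where "Y = {x \<in> F. rotate1 x \<noteq> x}"
  define orb where "orb = (\<lambda>x :: 'a list. (\<lambda>i. rotate i x) ` {..<l})"
  have closedi: "rotate i x \<in> F" if "x \<in> F" for i x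
    using that by (induction i) (auto simp: closed)
  have orbr: "orb x = range (\<lambda>i. rotate i x)" if "x \<in> F" for x
    unfolding orb_def by (rule rotate_orbit_eq) (use F(2)[OF that] prime_gt_0_nat[OF l] in auto)
  have unrot: "\<exists>j. x = rotate j (rotate i x)" if "x \<in> F" for i x
  proof -
    have "rotate (l * i - i + i) x = rotate (l * i) x"
      using prime_gt_0_nat[OF l] by simp
    also have "\<dots> = x" using rotate_conv_mod[of "l * i" x] F(2)[OF that] by simp
    finally show ?thesis by (metis rotate_rotate)
  qed
  have orbY: "orb x \<subseteq> Y" if xY: "x \<in> Y" for x
  proof
    fix y assume "y \<in> orb x"
    then obtain i where i: "y = rotate i x" by (auto simp: orb_def)
    obtain j where j: "x = rotate j y" using unrot[of x i] xY i by (auto simp: Y_def)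
    have "rotate1 y \<noteq> y"
    proof
      assume "rotate1 y = y"
      then have "rotate k y = y" for k by (induction k) auto
      then show False using j \<open>rotate1 y = y\<close> xY by (simp add: Y_def)
    qed
    then show "y \<in> Y" using closedi[of x i] xY i by (simp add: Y_def)
  qed
  have self: "x \<in> orb x" for x
    unfolding orb_def using prime_gt_0_nat[OF l] by (intro image_eqI[of _ _ 0]) auto
  have sub: "orb (rotate i x) \<subseteq> orb x" if "x \<in> F" for x i
    unfolding orbr[OF that] by (auto simp: orb_def rotate_rotate)
  have orb_eq: "orb y = orb x" if x: "x \<in> F" and y: "y \<in> orb x" for x y
  proof -
    obtain i where i: "y = rotate i x" using y by (auto simp: orb_def)
    have yF: "y \<in> F" using closedi x i by simp
    obtain j where j: "x = rotate j y" using unrot[OF x, of i] i by auto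
    show ?thesis using sub[OF x, of i, folded i] sub[OF yF, of j, folded j] by blast
  qed
  have U: "\<Union> (orb ` Y) = Y" using orbY self by blast
  have "l dvd card (\<Union> (orb ` Y))"
  proof (rule dvd_partition)
    show "finite (\<Union> (orb ` Y))" unfolding U using F by (simp add: Y_def)
    show "\<forall>c\<in>orb ` Y. l dvd card c"
    proof
      fix c assume "c \<in> orb ` Y"
      then obtain x where x: "x \<in> F" "rotate1 x \<noteq> x" "c = orb x" by (auto simp: Y_def)
      then show "l dvd card c" using card_rotate_orbit[of x] F(2)[OF x(1)] l by (simp add: orb_def)
    qed
    show "\<forall>c1\<in>orb ` Y. \<forall>c2\<in>orb ` Y. c1 \<noteq> c2 \<longrightarrow> c1 \<inter> c2 = {}"
    proof (intro ballI impI)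
      fix c1 c2 assume "c1 \<in> orb ` Y" "c2 \<in> orb ` Y" "c1 \<noteq> c2"
      then obtain x y where xy: "x \<in> F" "y \<in> F" "c1 = orb x" "c2 = orb y" by (auto simp: Y_def)
      show "c1 \<inter> c2 = {}"
      proof (rule ccontr)
        assume "c1 \<inter> c2 \<noteq> {}"
        then obtain w where "w \<in> orb x" "w \<in> orb y" using xy by auto
        then have "orb x = orb y" using orb_eq[OF xy(1), of w] orb_eq[OF xy(2), of w] by metis
        then show False using xy(3,4) \<open>c1 \<noteq> c2\<close> by simp
      qed
    qed
  qed
  then have "l dvd card Y" by (simp add: U)
  moreover have "card F = card Y + card {x \<in> F. rotate1 x = x}"
    unfolding Y_def using F(1) by (subst card_Un_disjoint[symmetric]) (auto intro!: arg_cong[of _ _ card])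
  ultimately show ?thesis by (simp add: cong_def mod_add_eq[symmetric, of "card Y"])
qed

lemma rotate1_fixed_replicate: "rotate1 xs = xs \<Longrightarrow> \<exists>t. xs = replicate (length xs) t"
proof (induction xs)
  case (Cons x xs)
  then have "card (set (x # xs)) = 1" using rotate1_fixpoint_card by blast
  then obtain t where "set (x # xs) = {t}" by (auto simp: card_1_singleton_iff)
  then show ?case by (metis replicate_length_same singletonD)
qed simp

text \<open>
  The cardinality of this set is the coefficient of \<open>g\<close> in the \<open>j\<close>-th power of \<open>B\<close> in the group ring.
\<close>

definition tuples :: "('a, 'm) monoid_scheme \<Rightarrow> 'a set \<Rightarrow> nat \<Rightarrow> 'a \<Rightarrow> 'a list set" where
  "tuples G B j g = {xs. length xs = j \<and> set xs \<subseteq> B \<and> foldr (monoid.mult G) xs \<one>\<^bsub>G\<^esub> = g}"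

lemma finite_tuples: "finite B \<Longrightarrow> finite (tuples G B j g)"
  unfolding tuples_def by (rule finite_subset[OF _ finite_lists_length_eq[of B j]]) auto

context comm_group
begin

lemma foldr_mult_closed: "set xs \<subseteq> carrier G \<Longrightarrow> foldr (\<otimes>) xs \<one> \<in> carrier G"
  by (induction xs) auto

lemma foldr_mult_snoc:
  "set xs \<subseteq> carrier G \<Longrightarrow> x \<in> carrier G \<Longrightarrow> foldr (\<otimes>) (xs @ [x]) \<one> = x \<otimes> foldr (\<otimes>) xs \<one>"
proof (induction xs)
  case (Cons y xs)
  then show ?case using foldr_mult_closed[of xs] by (simp add: m_lcomm)
qed auto

lemma foldr_mult_replicate: "t \<in> carrier G \<Longrightarrow> foldr (\<otimes>) (replicate n t) \<one> = t [^] n"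
  by (induction n) (auto simp: m_comm)

text \<open>
  Frobenius in the group ring: \<open>B\<^sup>l\<close> is congruent modulo \<open>l\<close> to the sum of the \<open>l\<close>-th powers of the
  elements of \<open>B\<close>.  In an abelian group rotating a tuple preserves its product, and the tuples fixed
  by rotation are the constant ones.
\<close>

lemma card_tuples_prime:
  assumes l: "normalization_semidom_class.prime l" and B: "finite B" "B \<subseteq> carrier G"
  shows "[card (tuples G B l g) = card {t \<in> B. t [^] l = g}] (mod l)"
proof -
  have "[card (tuples G B l g) = card {xs \<in> tuples G B l g. rotate1 xs = xs}] (mod l)"
  proof (rule card_mod_prime_rotate_fixed[OF l finite_tuples[OF B(1)]])
    fix xs assume xs: "xs \<in> tuples G B l g"
    then show "length xs = l" by (simp add: tuples_def)
    show "rotate1 xs \<in> tuples G B l g"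
    proof (cases xs)
      case (Cons y ys)
      then have "foldr (\<otimes>) (ys @ [y]) \<one> = foldr (\<otimes>) xs \<one>"
        using xs B by (subst foldr_mult_snoc) (auto simp: tuples_def)
      then show ?thesis using Cons xs by (simp add: tuples_def)
    qed (use xs in simp)
  qed
  also have "{xs \<in> tuples G B l g. rotate1 xs = xs} = replicate l ` {t \<in> B. t [^] l = g}"
    (is "?L = ?R")
  proof
    show "?L \<subseteq> ?R"
    proof
      fix xs assume "xs \<in> ?L"
      then have xs: "xs \<in> tuples G B l g" "rotate1 xs = xs" by auto
      from rotate1_fixed_replicate[OF xs(2)] obtain t where t: "xs = replicate l t"
        using xs(1) by (auto simp: tuples_def)
      then show "xs \<in> ?R" using xs(1) prime_gt_0_nat[OF l] B foldr_mult_replicate[of t l]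
        by (auto simp: tuples_def)
    qed
    show "?R \<subseteq> ?L"
      using B prime_gt_0_nat[OF l] by (auto simp: tuples_def foldr_mult_replicate subset_iff simp del: foldr_replicate)
  qed
  also have "card \<dots> = card {t \<in> B. t [^] l = g}"
    using prime_gt_0_nat[OF l] by (intro card_image) (auto simp: inj_on_def replicate_eq_replicate)
  finally show ?thesis .
qed

lemma card_tuples_Suc:
  assumes B: "finite B" "B \<subseteq> carrier G" and g: "g \<in> carrier G"
  shows "card (tuples G B (Suc j) g) = (\<Sum>t\<in>B. card (tuples G B j (inv t \<otimes> g)))"
proof -
  have "tuples G B (Suc j) g = (\<Union>t\<in>B. (#) t ` tuples G B j (inv t \<otimes> g))" (is "?L = ?R")
  proof
    show "?L \<subseteq> ?R"
    proof
      fix xs assume xs: "xs \<in> ?L"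
      then obtain t ys where ty: "xs = t # ys" by (auto simp: tuples_def length_Suc_conv)
      then have "t \<in> B" "t \<in> carrier G" "set ys \<subseteq> carrier G" "t \<otimes> foldr (\<otimes>) ys \<one> = g"
        using xs B by (auto simp: tuples_def)
      then have "foldr (\<otimes>) ys \<one> = inv t \<otimes> g" using foldr_mult_closed[of ys] g
        by (metis inv_solve_left)
      then show "xs \<in> ?R" using xs ty \<open>t \<in> B\<close> by (auto simp: tuples_def)
    qed
    show "?R \<subseteq> ?L" using B g by (auto simp: tuples_def subset_iff m_assoc[symmetric])
  qed
  also have "card \<dots> = (\<Sum>t\<in>B. card ((#) t ` tuples G B j (inv t \<otimes> g)))"
    using B by (intro card_UN_disjoint) (auto simp: finite_tuples)
  finally show ?thesis by (simp add: card_image)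
qed

lemma nat_pow_coprime_order_inj:
  assumes "finite (carrier G)" and "coprime l (order G)"
    and x: "x \<in> carrier G" and y: "y \<in> carrier G" and eq: "x [^] l = y [^] (l::nat)"
  shows "x = y"
proof -
  obtain k where k: "[l * k = Suc 0] (mod order G)" using assms(2) cong_solve_coprime_nat by blast
  have red: "u [^] n = u [^] (n mod order G)" if u: "u \<in> carrier G" for u and n :: nat
  proof -
    have "u [^] n = u [^] (order G * (n div order G) + n mod order G)" by simp
    also have "\<dots> = (u [^] order G) [^] (n div order G) \<otimes> u [^] (n mod order G)"
      using u by (simp only: nat_pow_pow nat_pow_mult)
    finally show ?thesis using u by (simp add: pow_order_eq_1)
  qed
  have "u [^] (l * k) = u" if u: "u \<in> carrier G" for u
    using red[OF u, of "l * k"] red[OF u, of "Suc 0"] k u by (simp add: cong_def)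
  then show ?thesis using eq x y by (metis nat_pow_pow)
qed

end

context comm_group
begin

text \<open>
  If \<open>B\<^sup>2\<close> is a constant function modulo \<open>l\<close>, so is every higher power and in particular \<open>B\<^sup>l\<close>.  By
  Frobenius \<open>B\<^sup>l\<close> is, up to the bijection \<open>x \<mapsto> x\<^sup>l\<close>, the indicator function of \<open>B\<close> modulo \<open>l\<close>.
\<close>

theorem trivial_if_square_constant_mod_prime:
  assumes fin: "finite (carrier G)" and B: "B \<subseteq> carrier G"
    and l: "normalization_semidom_class.prime l" "coprime l (order G)"
    and sq: "\<And>g. g \<in> carrier G \<Longrightarrow> [card {(s, t) \<in> B \<times> B. s \<otimes> t = g} = \<mu>] (mod l)"
  shows "B = {} \<or> B = carrier G"
proof -
  have finB: "finite B" using B fin finite_subset by blast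
  have tup2: "[card (tuples G B 2 g) = \<mu>] (mod l)" if g: "g \<in> carrier G" for g
  proof -
    have "tuples G B 2 g = (\<lambda>(s, t). [s, t]) ` {(s, t) \<in> B \<times> B. s \<otimes> t = g}"
      using B by (auto simp: tuples_def length_Suc_conv numeral_2_eq_2 image_iff subset_iff)
    then have "card (tuples G B 2 g) = card {(s, t) \<in> B \<times> B. s \<otimes> t = g}"
      by (simp add: card_image inj_on_def split_def prod_eq_iff)
    then show ?thesis using sq[OF g] by simp
  qed
  have const: "\<exists>c. \<forall>g\<in>carrier G. [card (tuples G B (j + 2) g) = c] (mod l)" for j
  proof (induction j)
    case 0
    then show ?case using tup2 by (intro exI[of _ \<mu>] ballI) (simp only: add_0)
  next
    case (Suc j)
    then obtain c where c: "\<And>g. g \<in> carrier G \<Longrightarrow> [card (tuples G B (j + 2) g) = c] (mod l)" by blast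
    have "[card (tuples G B (Suc j + 2) g) = (\<Sum>t\<in>B. c)] (mod l)" if g: "g \<in> carrier G" for g
    proof -
      have "card (tuples G B (Suc (j + 2)) g) = (\<Sum>t\<in>B. card (tuples G B (j + 2) (inv t \<otimes> g)))"
        by (rule card_tuples_Suc[OF finB B g])
      also have "[\<dots> = (\<Sum>t\<in>B. c)] (mod l)" using B g by (intro cong_sum c) auto
      finally show ?thesis by simp
    qed
    then show ?case by blast
  qed
  have l2: "l \<ge> 2" using prime_ge_2_nat[OF l(1)] .
  obtain c where c: "\<And>g. g \<in> carrier G \<Longrightarrow> [card (tuples G B l g) = c] (mod l)"
    using const[of "l - 2", unfolded le_add_diff_inverse2[OF l2]] by blast
  have pw: "[card {t \<in> B. t [^] l = g} = c] (mod l)" if "g \<in> carrier G" for g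
    using card_tuples_prime[OF l(1) finB B, of g] c[OF that] cong_sym cong_trans by blast
  have ind: "[(if h \<in> B then 1 else 0) = c] (mod l)" if h: "h \<in> carrier G" for h
  proof -
    have "{t \<in> B. t [^] l = h [^] l} = (if h \<in> B then {h} else {})"
      using nat_pow_coprime_order_inj[OF fin l(2) _ h] B by auto
    then show ?thesis using pw[of "h [^] l"] h by (simp split: if_splits)
  qed
  show ?thesis
  proof (rule ccontr)
    assume "\<not> ?thesis"
    then obtain a b where ab: "a \<in> B" "b \<in> carrier G" "b \<notin> B" using B by blast
    then have "[1 = c] (mod l)" "[0 = c] (mod l)" using ind[of a] ind[of b] B by auto
    then have "[1 = (0::nat)] (mod l)" using cong_sym cong_trans by blast
    then show False using l2 by (simp add: cong_def)
  qed
qed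

end

section \<open>Partial difference sets and regular abelian groups\<close>

lemma gring_mult_indicator:
  assumes "group G" "finite (carrier G)" "B \<subseteq> carrier G" "C \<subseteq> carrier G" "x \<in> carrier G"
  shows "gring_mult G (indicator B) (indicator C) x = int (card {y \<in> C. x \<otimes>\<^bsub>G\<^esub> inv\<^bsub>G\<^esub> y \<in> B})"
proof -
  interpret group G by fact
  have "gring_mult G (indicator B) (indicator C) x =
      (\<Sum>(y, z) \<in> {(y, z) \<in> carrier G \<times> carrier G. y \<otimes>\<^bsub>G\<^esub> z = x}. if y \<in> B \<and> z \<in> C then 1 else 0)"
    unfolding gring_mult_def by (intro sum.cong) (auto simp: indicator_def)
  also have "\<dots> = (\<Sum>(y, z) \<in> {(y, z) \<in> B \<times> C. y \<otimes>\<^bsub>G\<^esub> z = x}. 1)"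
    using assms by (intro sum.mono_neutral_cong_right) (auto intro: finite_subset[of _ "carrier G \<times> carrier G"])
  also have "\<dots> = int (card {(y, z) \<in> B \<times> C. y \<otimes>\<^bsub>G\<^esub> z = x})" by (simp add: split_def)
  also have "card {(y, z) \<in> B \<times> C. y \<otimes>\<^bsub>G\<^esub> z = x} = card {y \<in> C. x \<otimes>\<^bsub>G\<^esub> inv\<^bsub>G\<^esub> y \<in> B}"
  proof (rule bij_betw_same_card[of snd])
    show "bij_betw snd {(y, z) \<in> B \<times> C. y \<otimes>\<^bsub>G\<^esub> z = x} {y \<in> C. x \<otimes>\<^bsub>G\<^esub> inv\<^bsub>G\<^esub> y \<in> B}"
      using assms
      by (intro bij_betw_byWitness[where f' = "\<lambda>z. (x \<otimes>\<^bsub>G\<^esub> inv\<^bsub>G\<^esub> z, z)"])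
         (auto simp: subset_iff m_assoc inv_solve_right')
  qed
  finally show ?thesis .
qed

text \<open>
  The coefficients of \<open>(S + 1)\<^sup>2 = S\<^sup>2 + 2 S + 1\<close>, that is, the numbers of common neighbours when every
  vertex counts as a neighbour of itself.
\<close>

lemma pds_closed_common_neighbours:
  assumes pds: "partial_difference_set G S v k lam mu" and x: "x \<in> carrier G"
    and S': "S' = insert \<one>\<^bsub>G\<^esub> S"
  shows "int (card {y \<in> S'. x \<otimes>\<^bsub>G\<^esub> inv\<^bsub>G\<^esub> y \<in> S'}) =
    (if x = \<one>\<^bsub>G\<^esub> then k + 1 else if x \<in> S then lam + 2 else mu)"
proof -
  have G: "group G" "finite (carrier G)" "S \<subseteq> carrier G" "\<one>\<^bsub>G\<^esub> \<notin> S"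
    and eq: "gring_mult G (indicator S) (indicator S) =
       (\<lambda>x. k * indicator {\<one>\<^bsub>G\<^esub>} x + lam * indicator S x
          + mu * (indicator (carrier G) x - indicator S x - indicator {\<one>\<^bsub>G\<^esub>} x))"
    using pds by (auto simp: partial_difference_set_def)
  interpret group G by (rule G)
  have finS: "finite S" using G finite_subset by blast
  let ?A = "{y \<in> S. x \<otimes>\<^bsub>G\<^esub> inv\<^bsub>G\<^esub> y \<in> S}"
  have A: "int (card ?A) = k * indicator {\<one>\<^bsub>G\<^esub>} x + lam * indicator S x
          + mu * (1 - indicator S x - indicator {\<one>\<^bsub>G\<^esub>} x)"
    using gring_mult_indicator[OF G(1,2,3,3) x] x by (simp add: eq)
  have e: "x \<otimes>\<^bsub>G\<^esub> inv\<^bsub>G\<^esub> y = \<one>\<^bsub>G\<^esub> \<longleftrightarrow> y = x" if "y \<in> carrier G" for y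
    using that x by (metis inv_closed inv_inv inv_equality r_inv)
  consider "x = \<one>\<^bsub>G\<^esub>" | "x \<in> S" "x \<noteq> \<one>\<^bsub>G\<^esub>" | "x \<notin> S" "x \<noteq> \<one>\<^bsub>G\<^esub>" by blast
  then show ?thesis
  proof cases
    case 1
    then have "{y \<in> S'. x \<otimes>\<^bsub>G\<^esub> inv\<^bsub>G\<^esub> y \<in> S'} = insert \<one>\<^bsub>G\<^esub> ?A"
      using e G unfolding S' by auto
    then show ?thesis using 1 A G finS by simp
  next
    case 2
    then have "{y \<in> S'. x \<otimes>\<^bsub>G\<^esub> inv\<^bsub>G\<^esub> y \<in> S'} = insert \<one>\<^bsub>G\<^esub> (insert x ?A)"
      using e G x unfolding S' by auto
    moreover have "x \<notin> ?A" using G x by simp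
    ultimately show ?thesis using 2 A G finS by simp
  next
    case 3
    then have "{y \<in> S'. x \<otimes>\<^bsub>G\<^esub> inv\<^bsub>G\<^esub> y \<in> S'} = ?A"
      using e G x unfolding S' by auto
    then show ?thesis using 3 A G finS by simp
  qed
qed

text \<open>
  A regular group \<open>H\<close> of automorphisms is identified with the vertex set by \<open>h \<mapsto> h 1\<close>; the graph
  becomes a Cayley graph of \<open>H\<close> whose connection set together with the identity is the set \<open>D\<close> below.
  The two divisibility conditions say that the coefficients of \<open>(S + 1)\<^sup>2\<close> at \<open>1\<close> and on \<open>S\<close> both agree
  with \<open>\<mu>\<close> modulo \<open>l\<close>.
\<close>

theorem pds_genuinely_nonabelian:
  fixes l :: nat
  assumes pds: "partial_difference_set G S v k lam mu" and nontriv: "k + 1 < v"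
    and l: "normalization_semidom_class.prime l" "\<not> int l dvd v"
       "int l dvd k - mu + 1" "int l dvd lam - mu + 2"
  shows "genuinely_nonabelian G S"
  unfolding genuinely_nonabelian_def Let_def
proof
  define A where "A = graph_Aut (carrier G) (cayley_adj G S)"
  assume "\<exists>H. subgroup H (graph_Aut (carrier G) (cayley_adj G S)) \<and>
     comm_group (graph_Aut (carrier G) (cayley_adj G S)\<lparr>carrier := H\<rparr>) \<and> sharply_transitive_on H (carrier G)"
  then obtain H where H: "subgroup H A" "comm_group (A\<lparr>carrier := H\<rparr>)"
    and st: "sharply_transitive_on H (carrier G)" unfolding A_def by blast
  have G: "group G" "finite (carrier G)" "S \<subseteq> carrier G" "\<one>\<^bsub>G\<^esub> \<notin> S" "int (order G) = v" "int (card S) = k"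
    and mu: "0 < mu" "mu < k"
    using pds by (auto simp: partial_difference_set_def)
  interpret G: group G by (rule G)
  have finS: "finite S" using G finite_subset by blast
  define S' where "S' = insert \<one>\<^bsub>G\<^esub> S"
  define B where "B = A\<lparr>carrier := H\<rparr>"
  interpret B: comm_group B unfolding B_def by (rule H)
  have carB: "carrier B = H" by (simp add: B_def)
  have HA: "H \<subseteq> carrier A" using H(1) by (rule subgroup.subset)
  then have Hbij: "h \<in> Bij (carrier G)" if "h \<in> H" for h
    using that by (auto simp: A_def graph_Aut_def)
  have Hcl: "h x \<in> carrier G" if "h \<in> H" "x \<in> carrier G" for h x
    using Hbij[OF that(1)] that(2) by (auto simp: Bij_def bij_betw_def)
  have Hadj: "h x \<otimes>\<^bsub>G\<^esub> inv\<^bsub>G\<^esub> (h y) \<in> S' \<longleftrightarrow> x \<otimes>\<^bsub>G\<^esub> inv\<^bsub>G\<^esub> y \<in> S'"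
    if h: "h \<in> H" and xy: "x \<in> carrier G" "y \<in> carrier G" for h x y
  proof -
    have "(h x, h y) \<in> cayley_adj G S \<longleftrightarrow> (x, y) \<in> cayley_adj G S"
      using HA h xy by (auto simp: A_def graph_Aut_def)
    then have "h x \<otimes>\<^bsub>G\<^esub> inv\<^bsub>G\<^esub> (h y) \<in> S \<longleftrightarrow> x \<otimes>\<^bsub>G\<^esub> inv\<^bsub>G\<^esub> y \<in> S"
      using xy h Hcl by (simp add: cayley_adj_def)
    moreover have "h x = h y \<longleftrightarrow> x = y"
      using Hbij[OF h] xy by (auto simp: Bij_def bij_betw_def inj_on_def)
    moreover have "u \<otimes>\<^bsub>G\<^esub> inv\<^bsub>G\<^esub> w = \<one>\<^bsub>G\<^esub> \<longleftrightarrow> u = w" if "u \<in> carrier G" "w \<in> carrier G" for u w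
      using that by (metis G.inv_closed G.inv_inv G.inv_equality G.r_inv)
    ultimately show ?thesis using h xy Hcl by (simp add: S'_def)
  qed
  have mult: "(g \<otimes>\<^bsub>B\<^esub> f) x = g (f x)" if "g \<in> H" "f \<in> H" "x \<in> carrier G" for g f x
    using that Hbij by (simp add: B_def A_def graph_Aut_def BijGroup_def compose_eq)
  define ev where "ev = (\<lambda>h :: 'a \<Rightarrow> 'a. h \<one>\<^bsub>G\<^esub>)"
  have uniq: "\<exists>!h. h \<in> H \<and> h x = y" if "x \<in> carrier G" "y \<in> carrier G" for x y
    using st that by (auto simp: sharply_transitive_on_def)
  have inj: "g = h" if "g \<in> H" "h \<in> H" "x \<in> carrier G" "g x = h x" for g h x
    using uniq[of x "h x"] that Hcl by blast
  have bij: "bij_betw ev H (carrier G)"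
  proof (rule bij_betwI')
    show "\<And>x y. x \<in> H \<Longrightarrow> y \<in> H \<Longrightarrow> (ev x = ev y) = (x = y)"
      unfolding ev_def using inj[OF _ _ G.one_closed] by blast
    show "\<And>x. x \<in> H \<Longrightarrow> ev x \<in> carrier G" using Hcl by (simp add: ev_def)
    show "\<And>y. y \<in> carrier G \<Longrightarrow> \<exists>x\<in>H. y = ev x" unfolding ev_def using uniq[OF G.one_closed] by blast
  qed
  have finB: "finite (carrier B)" and ordB: "order B = order G"
    using bij bij_betw_finite[OF bij] bij_betw_same_card[OF bij] G by (simp_all add: carB order_def)
  define D where "D = {h \<in> H. ev h \<in> S'}"
  have S'sub: "S' \<subseteq> carrier G" using G by (simp add: S'_def)
  have sq: "[card {(s, t) \<in> D \<times> D. s \<otimes>\<^bsub>B\<^esub> t = g} = nat mu] (mod l)" if g: "g \<in> carrier B" for g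
  proof -
    define x where "x = ev g"
    have gH: "g \<in> H" using g carB by simp
    have x: "x \<in> carrier G" using gH Hcl by (simp add: x_def ev_def)
    \<comment> \<open>The automorphism \<open>s\<close> carries the pair \<open>(t 1, 1)\<close> to \<open>(g 1, s 1)\<close> when \<open>s t = g\<close>.\<close>
    have key: "t \<in> D \<longleftrightarrow> x \<otimes>\<^bsub>G\<^esub> inv\<^bsub>G\<^esub> (ev s) \<in> S'" if s: "s \<in> H" and t: "t \<in> H" and st: "s \<otimes>\<^bsub>B\<^esub> t = g" for s t
    proof -
      have "x = s (ev t)" using mult[OF s t G.one_closed] st by (simp add: x_def ev_def)
      then have "x \<otimes>\<^bsub>G\<^esub> inv\<^bsub>G\<^esub> (ev s) \<in> S' \<longleftrightarrow> ev t \<otimes>\<^bsub>G\<^esub> inv\<^bsub>G\<^esub> \<one>\<^bsub>G\<^esub> \<in> S'"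
        using Hadj[OF s, of "ev t" "\<one>\<^bsub>G\<^esub>"] Hcl[OF t] by (simp add: ev_def)
      then show ?thesis using t Hcl[OF t] by (simp add: D_def ev_def)
    qed
    have "bij_betw (\<lambda>(s, t). ev s) {(s, t) \<in> D \<times> D. s \<otimes>\<^bsub>B\<^esub> t = g} {y \<in> S'. x \<otimes>\<^bsub>G\<^esub> inv\<^bsub>G\<^esub> y \<in> S'}"
    proof (rule bij_betwI')
      fix p r assume p: "p \<in> {(s, t) \<in> D \<times> D. s \<otimes>\<^bsub>B\<^esub> t = g}" and r: "r \<in> {(s, t) \<in> D \<times> D. s \<otimes>\<^bsub>B\<^esub> t = g}"
      obtain s t s2 t2 where pr: "p = (s, t)" "r = (s2, t2)" by (cases p, cases r)
      have H4: "s \<in> H" "t \<in> H" "s2 \<in> H" "t2 \<in> H" "s \<otimes>\<^bsub>B\<^esub> t = g" "s2 \<otimes>\<^bsub>B\<^esub> t2 = g"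
        using p r pr by (auto simp: D_def)
      have "s = s2 \<Longrightarrow> t = t2" using H4 B.l_cancel[of s t t2] carB by simp
      moreover have "ev s = ev s2 \<Longrightarrow> s = s2" using inj[OF H4(1,3) G.one_closed] by (simp add: ev_def)
      ultimately show "((case p of (s, t) \<Rightarrow> ev s) = (case r of (s, t) \<Rightarrow> ev s)) = (p = r)"
        unfolding pr by auto
    next
      fix p assume p: "p \<in> {(s, t) \<in> D \<times> D. s \<otimes>\<^bsub>B\<^esub> t = g}"
      then show "(case p of (s, t) \<Rightarrow> ev s) \<in> {y \<in> S'. x \<otimes>\<^bsub>G\<^esub> inv\<^bsub>G\<^esub> y \<in> S'}"
        using key by (auto simp: D_def)
    next
      fix y assume y: "y \<in> {y \<in> S'. x \<otimes>\<^bsub>G\<^esub> inv\<^bsub>G\<^esub> y \<in> S'}"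
      then have "y \<in> carrier G" using S'sub by auto
      then obtain s where s: "s \<in> H" "ev s = y" using uniq[OF G.one_closed] unfolding ev_def by blast
      define t where "t = inv\<^bsub>B\<^esub> s \<otimes>\<^bsub>B\<^esub> g"
      have t: "t \<in> H" "s \<otimes>\<^bsub>B\<^esub> t = g"
        using s g carB unfolding t_def by (auto simp flip: B.m_assoc)
      then have "t \<in> D" using key[OF s(1)] s y by simp
      moreover have "s \<in> D" using s y by (simp add: D_def)
      ultimately show "\<exists>p\<in>{(s, t) \<in> D \<times> D. s \<otimes>\<^bsub>B\<^esub> t = g}. y = (case p of (s, t) \<Rightarrow> ev s)"
        using t s by (intro bexI[of _ "(s, t)"]) auto
    qed
    then have "card {(s, t) \<in> D \<times> D. s \<otimes>\<^bsub>B\<^esub> t = g} = card {y \<in> S'. x \<otimes>\<^bsub>G\<^esub> inv\<^bsub>G\<^esub> y \<in> S'}"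
      by (rule bij_betw_same_card)
    moreover have "[int (card {y \<in> S'. x \<otimes>\<^bsub>G\<^esub> inv\<^bsub>G\<^esub> y \<in> S'}) = int (nat mu)] (mod int l)"
      unfolding pds_closed_common_neighbours[OF pds x S'_def]
      using l(3,4) mu by (simp add: cong_iff_dvd_diff algebra_simps)
    ultimately show ?thesis by (simp only: cong_int_iff)
  qed
  have "\<not> l dvd order B" using l(2) G(5) ordB by auto
  then have "coprime l (order B)" using l(1) by (simp add: prime_imp_coprime)
  from B.trivial_if_square_constant_mod_prime[OF finB _ l(1) this sq]
  have "D = {} \<or> D = H" by (auto simp: D_def carB)
  moreover have "ev ` D = S'" using bij S'sub by (auto simp: D_def bij_betw_def)
  ultimately have "S' = {} \<or> S' = carrier G" using bij by (auto simp: bij_betw_def)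
  then have "card S' = card (carrier G)" by (auto simp: S'_def)
  moreover have "int (card S') = k + 1" using G finS by (simp add: S'_def)
  ultimately show False using nontriv G(5) by (simp add: order_def)
qed

section \<open>Constructing and transporting partial difference sets\<close>

text \<open>
  The group ring equation in terms of counting: \<open>x y\<^sup>-\<^sup>1 \<in> S\<close> says that \<open>x\<close> is the product of an element of
  \<open>S\<close> with \<open>y\<close>.
\<close>

lemma partial_difference_setI:
  assumes G: "group G" "finite (carrier G)" "int (order G) = v" and S: "S \<subseteq> carrier G" "\<one>\<^bsub>G\<^esub> \<notin> S"
    and inv: "\<And>s. s \<in> S \<Longrightarrow> inv\<^bsub>G\<^esub> s \<in> S"
    and cnt: "\<And>x. x \<in> carrier G \<Longrightarrow> int (card {y \<in> S. x \<otimes>\<^bsub>G\<^esub> inv\<^bsub>G\<^esub> y \<in> S}) =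
       (if x = \<one>\<^bsub>G\<^esub> then k else if x \<in> S then lam else mu)"
    and mu: "0 < mu" "mu < k"
  shows "partial_difference_set G S v k lam mu"
proof -
  interpret group G by (rule G)
  have "{y \<in> S. \<one>\<^bsub>G\<^esub> \<otimes>\<^bsub>G\<^esub> inv\<^bsub>G\<^esub> y \<in> S} = S" using inv S by auto
  then have k: "int (card S) = k" using cnt[of "\<one>\<^bsub>G\<^esub>"] by simp
  have "s \<in> (\<lambda>s. inv\<^bsub>G\<^esub> s) ` S" if "s \<in> S" for s
    using inv[OF that] S that by (intro image_eqI[of _ _ "inv\<^bsub>G\<^esub> s"]) auto
  then have sym: "S = {inv\<^bsub>G\<^esub> s | s. s \<in> S}" using inv by blast
  have "gring_mult G (indicator S) (indicator S) x =
      k * indicator {\<one>\<^bsub>G\<^esub>} x + lam * indicator S x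
          + mu * (indicator (carrier G) x - indicator S x - indicator {\<one>\<^bsub>G\<^esub>} x)" for x
  proof (cases "x \<in> carrier G")
    case True
    then show ?thesis using gring_mult_indicator[OF G(1,2) S(1) S(1) True] cnt[OF True] S by simp
  next
    case False
    then have "{(y, z) \<in> carrier G \<times> carrier G. y \<otimes>\<^bsub>G\<^esub> z = x} = {}" by auto
    then have "gring_mult G (indicator S) (indicator S) x = 0" by (simp only: gring_mult_def sum.empty)
    then show ?thesis using False S by (auto simp: indicator_def)
  qed
  then show ?thesis using assms k sym unfolding partial_difference_set_def by blast
qed

lemma partial_difference_set_nat:
  assumes pds: "partial_difference_set G S v k lam mu"
  shows "\<exists>(G' :: nat monoid) S'. partial_difference_set G' S' v k lam mu"
proof -
  have G: "group G" "finite (carrier G)" "S \<subseteq> carrier G" "\<one>\<^bsub>G\<^esub> \<notin> S" "int (order G) = v"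
    "S = {inv\<^bsub>G\<^esub> s | s. s \<in> S}" "int (card S) = k" and mu: "0 < mu" "mu < k"
    and eq: "gring_mult G (indicator S) (indicator S) =
       (\<lambda>x. k * indicator {\<one>\<^bsub>G\<^esub>} x + lam * indicator S x
          + mu * (indicator (carrier G) x - indicator S x - indicator {\<one>\<^bsub>G\<^esub>} x))"
    using pds by (auto simp: partial_difference_set_def)
  interpret group G by (rule G)
  obtain f :: "'a \<Rightarrow> nat" where f: "inj_on f (carrier G)"
    using finite_imp_inj_to_nat_seg[OF G(2)] by blast
  define g where "g = inv_into (carrier G) f"
  have gf [simp]: "g (f x) = x" if "x \<in> carrier G" for x using f that by (simp add: g_def)
  define G' where "G' = \<lparr>carrier = f ` carrier G, monoid.mult = (\<lambda>x y. f (g x \<otimes>\<^bsub>G\<^esub> g y)), one = f \<one>\<^bsub>G\<^esub>\<rparr>"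
  have grp: "group G'"
  proof (rule groupI)
    fix x assume "x \<in> carrier G'"
    then obtain a where "a \<in> carrier G" "x = f a" by (auto simp: G'_def)
    then show "\<exists>y\<in>carrier G'. y \<otimes>\<^bsub>G'\<^esub> x = \<one>\<^bsub>G'\<^esub>"
      by (intro bexI[of _ "f (inv\<^bsub>G\<^esub> a)"]) (auto simp: G'_def)
  qed (auto simp: G'_def m_assoc)
  interpret G': group G' by (rule grp)
  have inv': "inv\<^bsub>G'\<^esub> (f a) = f (inv\<^bsub>G\<^esub> a)" if "a \<in> carrier G" for a
    using that by (intro G'.inv_equality) (auto simp: G'_def)
  have fS: "f a \<in> f ` S \<longleftrightarrow> a \<in> S" if "a \<in> carrier G" for a
    using f that G(3) by (auto simp: inj_on_def subset_iff)
  have "partial_difference_set G' (f ` S) v k lam mu"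
  proof (rule partial_difference_setI[OF grp])
    show "finite (carrier G')" using G by (simp add: G'_def)
    show "int (order G') = v" using G(5) f by (simp add: order_def G'_def card_image)
    show "f ` S \<subseteq> carrier G'" using G by (auto simp: G'_def)
    show "\<one>\<^bsub>G'\<^esub> \<notin> f ` S" using fS[of "\<one>\<^bsub>G\<^esub>"] G by (simp add: G'_def)
    show "inv\<^bsub>G'\<^esub> s \<in> f ` S" if "s \<in> f ` S" for s
      using that G(3,6) inv' by auto
    fix x assume "x \<in> carrier G'"
    then obtain a where a: "a \<in> carrier G" "x = f a" by (auto simp: G'_def)
    have "{y \<in> f ` S. x \<otimes>\<^bsub>G'\<^esub> inv\<^bsub>G'\<^esub> y \<in> f ` S} = f ` {y \<in> S. a \<otimes>\<^bsub>G\<^esub> inv\<^bsub>G\<^esub> y \<in> S}"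
    proof -
      have "x \<otimes>\<^bsub>G'\<^esub> inv\<^bsub>G'\<^esub> (f y) \<in> f ` S \<longleftrightarrow> a \<otimes>\<^bsub>G\<^esub> inv\<^bsub>G\<^esub> y \<in> S" if "y \<in> S" for y
      proof -
        have y: "y \<in> carrier G" using that G(3) by auto
        have "x \<otimes>\<^bsub>G'\<^esub> inv\<^bsub>G'\<^esub> (f y) = f (a \<otimes>\<^bsub>G\<^esub> inv\<^bsub>G\<^esub> y)"
          unfolding inv'[OF y] using a y by (simp add: G'_def)
        then show ?thesis using fS a y by simp
      qed
      then show ?thesis by auto
    qed
    moreover have "inj_on f {y \<in> S. a \<otimes>\<^bsub>G\<^esub> inv\<^bsub>G\<^esub> y \<in> S}" using f G(3) by (auto intro: inj_on_subset)
    ultimately have "card {y \<in> f ` S. x \<otimes>\<^bsub>G'\<^esub> inv\<^bsub>G'\<^esub> y \<in> f ` S} = card {y \<in> S. a \<otimes>\<^bsub>G\<^esub> inv\<^bsub>G\<^esub> y \<in> S}"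
      by (simp add: card_image)
    moreover have "int (card {y \<in> S. a \<otimes>\<^bsub>G\<^esub> inv\<^bsub>G\<^esub> y \<in> S}) =
       (if a = \<one>\<^bsub>G\<^esub> then k else if a \<in> S then lam else mu)"
    proof -
      have h: "int (card {y \<in> S. a \<otimes>\<^bsub>G\<^esub> inv\<^bsub>G\<^esub> y \<in> S}) = k * indicator {\<one>\<^bsub>G\<^esub>} a + lam * indicator S a
          + mu * (1 - indicator S a - indicator {\<one>\<^bsub>G\<^esub>} a)"
        using gring_mult_indicator[OF G(1,2,3,3) a(1)] a by (simp add: eq)
      show ?thesis unfolding h using G(4) by (auto simp: indicator_def)
    qed
    moreover have "x = \<one>\<^bsub>G'\<^esub> \<longleftrightarrow> a = \<one>\<^bsub>G\<^esub>" using a f by (auto simp: G'_def inj_on_def)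
    ultimately show "int (card {y \<in> f ` S. x \<otimes>\<^bsub>G'\<^esub> inv\<^bsub>G'\<^esub> y \<in> f ` S}) =
       (if x = \<one>\<^bsub>G'\<^esub> then k else if x \<in> f ` S then lam else mu)"
      using fS[OF a(1)] a(2) by simp
  qed (use mu in auto)
  then show ?thesis by blast
qed

text \<open>
  The coefficient of \<open>x\<close> in the group ring product \<open>B C\<close>.
\<close>

definition quotient_count :: "('a, 'm) monoid_scheme \<Rightarrow> 'a set \<Rightarrow> 'a set \<Rightarrow> 'a \<Rightarrow> int" where
  "quotient_count G B C x = int (card {y \<in> C. x \<otimes>\<^bsub>G\<^esub> inv\<^bsub>G\<^esub> y \<in> B})"

text \<open>
  Write \<open>W\<close> for the sum of all \<open>Y\<^sub>u\<close>.  The set in question is \<open>W + Z - m\<close> in the group ring, since the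
  identity lies in \<open>Z\<close> and in all \<open>m - 1\<close> sets \<open>Y\<^sub>u\<close>.  Every \<open>w\<close> in \<open>U - 1\<close> can be written as \<open>u v\<close> with
  \<open>u, v \<noteq> 1\<close> in exactly \<open>m - 2\<close> ways, so
  \<open>W\<^sup>2 = (m - 1) (q\<^sup>2 + q (G - Z)) + (m - 1) (m - 2) (q + 1) G - q (m - 2) W\<close>.  Expanding the square of
  \<open>W + Z - m\<close> gives \<open>W\<close> and \<open>Z\<close> the same coefficient \<open>- q (m - 2) - 2 m\<close>, which is \<open>\<lambda> - \<mu>\<close>.
\<close>

theorem pds_of_multiplicative_family:
  fixes G :: "('a, 'm) monoid_scheme" and U :: "('u, 'n) monoid_scheme" and q m :: nat
  defines "M \<equiv> carrier U - {\<one>\<^bsub>U\<^esub>}"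
  assumes G: "group G" "finite (carrier G)" "order G = q ^ 3"
    and U: "group U" "finite (carrier U)" "order U = m" and m: "2 \<le> m" "m < q"
    and Y: "\<And>u. u \<in> M \<Longrightarrow> Y u \<subseteq> carrier G" "\<And>u. u \<in> M \<Longrightarrow> \<one>\<^bsub>G\<^esub> \<in> Y u" 
    and Z: "Z \<subseteq> carrier G" "\<one>\<^bsub>G\<^esub> \<in> Z"
    and YY: "\<And>u v. u \<in> M \<Longrightarrow> v \<in> M \<Longrightarrow> u \<noteq> v \<Longrightarrow> Y u \<inter> Y v = {\<one>\<^bsub>G\<^esub>}"
    and YZ: "\<And>u. u \<in> M \<Longrightarrow> Y u \<inter> Z = {\<one>\<^bsub>G\<^esub>}"
    and invY: "\<And>u y. u \<in> M \<Longrightarrow> y \<in> Y u \<Longrightarrow> inv\<^bsub>G\<^esub> y \<in> Y (inv\<^bsub>U\<^esub> u)"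
    and invZ: "\<And>z. z \<in> Z \<Longrightarrow> inv\<^bsub>G\<^esub> z \<in> Z"
    and cYY: "\<And>u v x. u \<in> M \<Longrightarrow> v \<in> M \<Longrightarrow> u \<otimes>\<^bsub>U\<^esub> v \<noteq> \<one>\<^bsub>U\<^esub> \<Longrightarrow> x \<in> carrier G \<Longrightarrow>
       quotient_count G (Y u) (Y v) x = int q + 1 - int q * indicator (Y (u \<otimes>\<^bsub>U\<^esub> v)) x"
    and cYY1: "\<And>u v x. u \<in> M \<Longrightarrow> v \<in> M \<Longrightarrow> u \<otimes>\<^bsub>U\<^esub> v = \<one>\<^bsub>U\<^esub> \<Longrightarrow> x \<in> carrier G \<Longrightarrow>
       quotient_count G (Y u) (Y v) x = int q ^ 2 * indicator {\<one>\<^bsub>G\<^esub>} x + int q * (1 - indicator Z x)"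
    and cYZ: "\<And>u x. u \<in> M \<Longrightarrow> x \<in> carrier G \<Longrightarrow> quotient_count G (Y u) Z x = 1"
    and cZY: "\<And>u x. u \<in> M \<Longrightarrow> x \<in> carrier G \<Longrightarrow> quotient_count G Z (Y u) x = 1"
    and cZZ: "\<And>x. x \<in> carrier G \<Longrightarrow> quotient_count G Z Z x = int q * indicator Z x"
  shows "partial_difference_set G (((\<Union>u\<in>M. Y u) \<union> Z) - {\<one>\<^bsub>G\<^esub>}) (int q ^ 3)
    ((int q - 1) * ((int q + 1) * (int m - 1) + 1))
    ((int m - 1) * ((int q + 1) * (int m - 1) + 1) + 2 * int q - int q * int m - 2 * int m)
    ((int m - 1) * ((int q + 1) * (int m - 1) + 1))" (is "partial_difference_set G ?S _ ?k ?lam ?mu")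
proof -
  interpret group G by (rule G)
  interpret U: group U by (rule U)
  let ?one = "\<one>\<^bsub>G\<^esub>"
  define S where "S = ?S"
  have M: "finite M" "int (card M) = int m - 1"
    using U m by (simp_all add: M_def order_def of_nat_diff)
  have MU: "u \<in> carrier U" if "u \<in> M" for u using that by (simp add: M_def)
  have Minv: "inv\<^bsub>U\<^esub> u \<in> M" if "u \<in> M" for u
    using that U.inv_eq_1_iff by (auto simp: M_def)
  have SG: "S \<subseteq> carrier G" using Y Z by (auto simp: S_def)
  define W where "W = (\<lambda>x. \<Sum>u\<in>M. (indicator (Y u) x :: int))"
  have W_out: "W x = 0" if "\<And>u. u \<in> M \<Longrightarrow> x \<notin> Y u" for x
    unfolding W_def using that by (intro sum.neutral) simp
  have W_in: "W x = 1" if u: "u \<in> M" "x \<in> Y u" and x: "x \<noteq> ?one" for x u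
  proof -
    have "x \<notin> Y v" if "v \<in> M - {u}" for v using YY[OF u(1), of v] that u x by blast
    then have "(\<Sum>v\<in>M - {u}. (indicator (Y v) x :: int)) = 0" by (intro sum.neutral) simp
    then show ?thesis unfolding W_def using u M by (simp add: sum.remove[of M u])
  qed
  have W_one: "W ?one = int m - 1" unfolding W_def using Y(2) M by simp
  have indS: "indicator S x = W x + indicator Z x - int m * indicator {?one} x" if "x \<in> carrier G" for x
  proof -
    consider "x = ?one" | u where "u \<in> M" "x \<in> Y u" "x \<noteq> ?one" "x \<notin> Z" | "x \<in> Z" "x \<noteq> ?one" "\<And>u. u \<in> M \<Longrightarrow> x \<notin> Y u"
      | "x \<notin> Z" "x \<noteq> ?one" "\<And>u. u \<in> M \<Longrightarrow> x \<notin> Y u"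
      using YZ by blast
    then show ?thesis
    proof cases
      case 1 then show ?thesis using W_one Z by (simp add: S_def)
    next
      case 2 then show ?thesis using W_in[OF 2(1-3)] by (auto simp: S_def indicator_def)
    next
      case 3 then show ?thesis using W_out[OF 3(3)] by (simp add: S_def)
    next
      case 4 then show ?thesis using W_out[OF 4(3)] by (auto simp: S_def indicator_def)
    qed
  qed
  have count: "int (card {y \<in> S. x \<otimes>\<^bsub>G\<^esub> inv\<^bsub>G\<^esub> y \<in> S}) =
      (if x = ?one then ?k else if x \<in> S then ?lam else ?mu)" if x: "x \<in> carrier G" for x
  proof -
    \<comment> \<open>The value at \<open>x\<close> of the group ring product, as a bilinear form.\<close>
    define cv where "cv = (\<lambda>(f :: 'a \<Rightarrow> int) g. \<Sum>y\<in>carrier G. f (x \<otimes>\<^bsub>G\<^esub> inv\<^bsub>G\<^esub> y) * g y)"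
    have cv_ind: "cv (indicator B) (indicator C) = quotient_count G B C x" if "C \<subseteq> carrier G" for B C
    proof -
      have "cv (indicator B) (indicator C) = (\<Sum>y\<in>carrier G. if y \<in> {y \<in> C. x \<otimes>\<^bsub>G\<^esub> inv\<^bsub>G\<^esub> y \<in> B} then 1 else 0)"
        unfolding cv_def by (intro sum.cong) (auto simp: indicator_def)
      also have "\<dots> = (\<Sum>y\<in>carrier G \<inter> {y \<in> C. x \<otimes>\<^bsub>G\<^esub> inv\<^bsub>G\<^esub> y \<in> B}. 1)"
        by (rule sum.inter_restrict[OF G(2), symmetric])
      also have "carrier G \<inter> {y \<in> C. x \<otimes>\<^bsub>G\<^esub> inv\<^bsub>G\<^esub> y \<in> B} = {y \<in> C. x \<otimes>\<^bsub>G\<^esub> inv\<^bsub>G\<^esub> y \<in> B}" using that by auto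
      finally show ?thesis by (simp add: quotient_count_def)
    qed
    have cv_addl: "cv (\<lambda>h. f h + f' h) g = cv f g + cv f' g" for f f' g
      by (simp add: cv_def distrib_right sum.distrib)
    have cv_addr: "cv f (\<lambda>h. g h + g' h) = cv f g + cv f g'" for f g g'
      by (simp add: cv_def distrib_left sum.distrib)
    have cv_subl: "cv (\<lambda>h. f h - c * f' h) g = cv f g - c * cv f' g" for f f' g c
      by (simp add: cv_def left_diff_distrib sum_subtractf sum_distrib_left mult.assoc)
    have cv_subr: "cv f (\<lambda>h. g h - c * g' h) = cv f g - c * cv f g'" for f g g' c
      by (simp add: cv_def right_diff_distrib sum_subtractf sum_distrib_left mult.left_commute)
    have cv_suml: "cv W g = (\<Sum>u\<in>M. cv (indicator (Y u)) g)" for g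
      unfolding cv_def W_def sum_distrib_right by (rule sum.swap)
    have cv_sumr: "cv f W = (\<Sum>u\<in>M. cv f (indicator (Y u)))" for f
      unfolding cv_def W_def sum_distrib_left by (rule sum.swap)
    have cv_oner: "cv f (indicator {?one}) = f x" for f
    proof -
      have "cv f (indicator {?one}) = (\<Sum>y\<in>{?one}. f (x \<otimes>\<^bsub>G\<^esub> inv\<^bsub>G\<^esub> y) * indicator {?one} y)"
        unfolding cv_def using G by (intro sum.mono_neutral_right) auto
      then show ?thesis using x by simp
    qed
    have cv_onel: "cv (indicator {?one}) g = g x" for g
    proof -
      have e: "x \<otimes>\<^bsub>G\<^esub> inv\<^bsub>G\<^esub> y = ?one \<longleftrightarrow> y = x" if "y \<in> carrier G" for y
        using that x by (metis inv_closed inv_inv inv_equality r_inv)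
      have "cv (indicator {?one}) g = (\<Sum>y\<in>{x}. indicator {?one} (x \<otimes>\<^bsub>G\<^esub> inv\<^bsub>G\<^esub> y) * g y)"
        unfolding cv_def using G x e by (intro sum.mono_neutral_right) auto
      then show ?thesis using x by simp
    qed
    define T where "T = (\<lambda>u v. cv (indicator (Y u)) (indicator (Y v)))"
    have T_sum: "(\<Sum>v\<in>M. T u v) = int q ^ 2 * indicator {?one} x + int q * (1 - indicator Z x)
       + (int m - 2) * (int q + 1) - int q * (W x - indicator (Y u) x)" if u: "u \<in> M" for u
    proof -
      let ?u' = "inv\<^bsub>U\<^esub> u"
      have Tu: "T u v = int q + 1 - int q * indicator (Y (u \<otimes>\<^bsub>U\<^esub> v)) x" if "v \<in> M - {?u'}" for v
      proof -
        have "u \<otimes>\<^bsub>U\<^esub> v \<noteq> \<one>\<^bsub>U\<^esub>"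
          using that u MU by (metis DiffD1 DiffD2 U.inv_equality U.inv_inv insertI1 U.inv_closed)
        then show ?thesis using that u x by (simp add: T_def cv_ind Y cYY)
      qed
      have "(\<Sum>v\<in>M. T u v) = T u ?u' + (\<Sum>v\<in>M - {?u'}. T u v)"
        using M Minv[OF u] by (simp add: sum.remove)
      also have "T u ?u' = int q ^ 2 * indicator {?one} x + int q * (1 - indicator Z x)"
        using u x Minv[OF u] MU[OF u] by (simp add: T_def cv_ind Y cYY1)
      also have "(\<Sum>v\<in>M - {?u'}. T u v) = (\<Sum>v\<in>M - {?u'}. int q + 1) - int q * (\<Sum>v\<in>M - {?u'}. indicator (Y (u \<otimes>\<^bsub>U\<^esub> v)) x)"
        using Tu by (simp add: sum_subtractf sum_distrib_left)
      also have "(\<Sum>v\<in>M - {?u'}. int q + 1) = (int m - 2) * (int q + 1)"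
        using M Minv[OF u] m by (simp add: of_nat_diff)
      also have "(\<Sum>v\<in>M - {?u'}. (indicator (Y (u \<otimes>\<^bsub>U\<^esub> v)) x :: int)) = (\<Sum>w\<in>M - {u}. indicator (Y w) x)"
      proof (rule sum.reindex_bij_betw[of "\<lambda>v. u \<otimes>\<^bsub>U\<^esub> v"])
        show "bij_betw (\<lambda>v. u \<otimes>\<^bsub>U\<^esub> v) (M - {?u'}) (M - {u})"
        proof (rule bij_betw_byWitness[where f' = "\<lambda>w. ?u' \<otimes>\<^bsub>U\<^esub> w"])
          show "\<forall>v\<in>M - {?u'}. ?u' \<otimes>\<^bsub>U\<^esub> (u \<otimes>\<^bsub>U\<^esub> v) = v"
            using MU u by (auto simp flip: U.m_assoc)
          show "\<forall>w\<in>M - {u}. u \<otimes>\<^bsub>U\<^esub> (?u' \<otimes>\<^bsub>U\<^esub> w) = w"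
            using MU u by (auto simp flip: U.m_assoc)
          show "(\<lambda>v. u \<otimes>\<^bsub>U\<^esub> v) ` (M - {?u'}) \<subseteq> M - {u}"
          proof (rule image_subsetI)
            fix v assume v: "v \<in> M - {?u'}"
            have "u \<otimes>\<^bsub>U\<^esub> v \<noteq> u" using v u by (auto simp: M_def)
            moreover have "u \<otimes>\<^bsub>U\<^esub> v \<noteq> \<one>\<^bsub>U\<^esub>"
              using v u MU by (metis DiffD1 DiffD2 U.inv_equality U.inv_inv insertI1 U.inv_closed)
            ultimately show "u \<otimes>\<^bsub>U\<^esub> v \<in> M - {u}" using v u by (auto simp: M_def)
          qed
          show "(\<lambda>w. ?u' \<otimes>\<^bsub>U\<^esub> w) ` (M - {u}) \<subseteq> M - {?u'}"
          proof (rule image_subsetI)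
            fix w assume w: "w \<in> M - {u}"
            have "?u' \<otimes>\<^bsub>U\<^esub> w \<noteq> ?u'" using w u by (auto simp: M_def)
            moreover have "?u' \<otimes>\<^bsub>U\<^esub> w \<noteq> \<one>\<^bsub>U\<^esub>"
              using w u MU by (metis DiffD1 DiffD2 U.inv_equality U.inv_inv insertI1 U.inv_closed)
            ultimately show "?u' \<otimes>\<^bsub>U\<^esub> w \<in> M - {?u'}" using w u by (auto simp: M_def)
          qed
        qed
      qed
      also have "(\<Sum>w\<in>M - {u}. (indicator (Y w) x :: int)) = W x - indicator (Y u) x"
        using M u by (simp add: W_def sum.remove)
      finally show ?thesis by simp
    qed
    have WW: "cv W W = (int m - 1) * (int q ^ 2 * indicator {?one} x + int q * (1 - indicator Z x)
       + (int m - 2) * (int q + 1)) - int q * ((int m - 1) * W x - W x)"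
    proof -
      have "cv W W = (\<Sum>u\<in>M. \<Sum>v\<in>M. T u v)" 
        unfolding T_def cv_suml[of W] by (intro sum.cong refl cv_sumr)
      also have "\<dots> = (\<Sum>u\<in>M. int q ^ 2 * indicator {?one} x + int q * (1 - indicator Z x)
       + (int m - 2) * (int q + 1) - int q * (W x - indicator (Y u) x))"
        by (intro sum.cong refl T_sum)
      also have "\<dots> = (int m - 1) * (int q ^ 2 * indicator {?one} x + int q * (1 - indicator Z x)
       + (int m - 2) * (int q + 1)) - int q * (\<Sum>u\<in>M. W x - indicator (Y u) x)"
        using M by (simp add: sum_subtractf flip: sum_distrib_left)
      also have "(\<Sum>u\<in>M. W x - indicator (Y u) x) = (int m - 1) * W x - W x"
        using M by (simp add: sum_subtractf W_def)
      finally show ?thesis .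
    qed
    have "int (card {y \<in> S. x \<otimes>\<^bsub>G\<^esub> inv\<^bsub>G\<^esub> y \<in> S}) = cv (indicator S) (indicator S)"
      using cv_ind[OF SG] by (simp add: quotient_count_def)
    also have "\<dots> = cv (\<lambda>h. W h + indicator Z h - int m * indicator {?one} h) (\<lambda>h. W h + indicator Z h - int m * indicator {?one} h)"
      unfolding cv_def using x by (intro sum.cong refl) (simp add: indS)
    also have "\<dots> = cv W W + 2 * (int m - 1) + int q * indicator Z x - 2 * int m * (W x + indicator Z x)
        + int m * int m * indicator {?one} x"
      unfolding cv_subl cv_subr cv_addl cv_addr cv_oner cv_onel cv_suml[of "indicator Z"] cv_sumr[of "indicator Z"]
      using x M by (simp add: cv_ind Y Z cYZ cZY cZZ algebra_simps)
    finally have total: "int (card {y \<in> S. x \<otimes>\<^bsub>G\<^esub> inv\<^bsub>G\<^esub> y \<in> S}) = \<dots>" .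
    consider "x = ?one" | u where "u \<in> M" "x \<in> Y u" "x \<noteq> ?one" "x \<notin> Z" | "x \<in> Z" "x \<noteq> ?one" "\<And>u. u \<in> M \<Longrightarrow> x \<notin> Y u"
      | "x \<notin> Z" "x \<noteq> ?one" "\<And>u. u \<in> M \<Longrightarrow> x \<notin> Y u"
      using YZ by blast
    then show ?thesis
    proof cases
      case 1
      then have Wx: "W x = int m - 1" using W_one by simp
      show ?thesis unfolding total WW Wx using 1 Z by (simp add: algebra_simps power2_eq_square)
    next
      case 2
      then have "x \<in> S" by (auto simp: S_def)
      then show ?thesis unfolding total WW using W_in[OF 2(1-3)] 2 by (simp add: algebra_simps power2_eq_square)
    next
      case 3
      then have "x \<in> S" by (auto simp: S_def)
      then show ?thesis unfolding total WW using W_out[OF 3(3)] 3 by (simp add: algebra_simps power2_eq_square)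
    next
      case 4
      then have "x \<notin> S" by (auto simp: S_def)
      then show ?thesis unfolding total WW using W_out[OF 4(3)] 4 by (simp add: algebra_simps power2_eq_square)
    qed
  qed
  have pos: "(int q + 1) * (int m - 1) + 1 > 0" using m by (simp add: add_pos_nonneg)
  show ?thesis unfolding S_def[symmetric]
  proof (rule partial_difference_setI[OF G(1,2) _ SG _ _ count])
    show "int (order G) = int q ^ 3" using G(3) by simp
    show "?one \<notin> S" by (simp add: S_def)
    show "inv\<^bsub>G\<^esub> s \<in> S" if "s \<in> S" for s
    proof -
      have "inv\<^bsub>G\<^esub> s \<in> (\<Union>u\<in>M. Y u) \<union> Z" using that invY invZ Minv by (auto simp: S_def) blast
      moreover have "inv\<^bsub>G\<^esub> s \<noteq> ?one" using that SG inv_eq_1_iff[of s] by (auto simp: S_def)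
      ultimately show ?thesis by (simp add: S_def)
    qed
    show "0 < ?mu" using pos m by simp
    show "?mu < ?k" using pos m by (intro mult_strict_right_mono) auto
  qed
qed

section \<open>A quadratic extension of finite fields\<close>

text \<open>
  The multiplicative group is cyclic.  Hence the condition on \<open>c\<close> makes it an \<open>n\<close>-th power, and there are
  exactly \<open>n\<close> elements with \<open>x\<^sup>n = 1\<close>.
\<close>

lemma (in field) card_nat_pow_eq:
  assumes fin: "finite (carrier R)" and n: "n dvd order R - 1"
    and c: "c \<in> carrier R" "c \<noteq> \<zero>" "c [^] ((order R - 1) div n) = \<one>"
  shows "card {x \<in> carrier R. x [^] n = c} = n"
proof -
  define N where "N = order R - 1"
  interpret M: group "Multiplicative_Group.mult_of R" by (rule field_mult_group)
  have finM: "finite (carrier (Multiplicative_Group.mult_of R))" using fin by (rule finite_mult_of)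
  have "card {\<zero>, \<one>} \<le> card (carrier R)" using fin by (intro card_mono) auto
  then have N: "N > 0" by (simp add: N_def order_def)
  have n0: "n > 0" using n N by (auto simp: N_def intro: Nat.gr0I)
  obtain e where e: "N = n * e" using n by (auto simp: N_def)
  have e0: "e > 0" using N e by (auto intro: Nat.gr0I)
  obtain a where a: "a \<in> carrier (Multiplicative_Group.mult_of R)" "carrier (Multiplicative_Group.mult_of R) = {a [^] i | i::nat. i \<in> UNIV}"
    using finite_field_mult_group_has_gen[OF fin] by blast
  have aR: "a \<in> carrier R" "a \<noteq> \<zero>" using a(1) by auto
  have cardM: "card (carrier (Multiplicative_Group.mult_of R)) = N"
    using order_mult_of[OF fin] by (simp add: order_def N_def)
  have "carrier (Multiplicative_Group.mult_of R) = (\<lambda>i. a [^] i) ` {0..M.ord a - 1}"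
    unfolding a(2) using M.ord_elems[OF finM a(1)]
    by (simp only: Multiplicative_Group.nat_pow_mult_of Setcompr_eq_image)
  then have "N \<le> card {0..M.ord a - 1}" using cardM card_image_le[of "{0..M.ord a - 1}" "\<lambda>i. a [^] i"] by simp
  then have "N \<le> M.ord a" using N M.ord_ge_1[OF finM a(1)] by simp
  then have ord: "M.ord a = N" using M.ord_le_group_order[OF finM a(1)] cardM by (simp add: order_def)
  have pow1: "a [^] (i::nat) = \<one> \<longleftrightarrow> N dvd i" for i
    using M.pow_eq_id[OF a(1), of i] by (simp add: Multiplicative_Group.nat_pow_mult_of ord)
  obtain i where i: "c = a [^] (i::nat)" using a(2) c by auto
  have "N div n = e" using e n0 by simp
  then have "a [^] (i * e) = \<one>" using c(3)[folded N_def] aR unfolding i by (simp add: nat_pow_pow)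
  then have "n dvd i" using e0 by (simp add: pow1 e)
  then obtain j where j: "i = n * j" by (auto simp: dvd_def)
  define b where "b = a [^] e"
  have b: "b \<in> carrier R" using aR by (simp add: b_def)
  define roots where "roots = {x \<in> carrier R. x [^] n = \<one>}"
  have inj: "inj_on (\<lambda>k. b [^] k) {..<n}"
  proof (rule linorder_inj_onI)
    fix k l assume kl: "k < l" "k \<in> {..<n}" "l \<in> {..<n}"
    show "b [^] k \<noteq> b [^] l"
    proof
      assume eq: "b [^] k = b [^] l"
      have "inj_on (\<lambda>x. a [^] x) {0..M.ord a - 1}" using M.ord_inj[OF a(1)] by (simp add: Multiplicative_Group.nat_pow_mult_of)
      moreover have "e * k \<le> N - 1" "e * l \<le> N - 1"
        using kl e0 N by (simp_all add: e mult.commute[of n] less_eq_Suc_le[symmetric] flip: less_Suc_eq_le)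
      ultimately have "e * k = e * l"
        using eq aR by (auto simp: ord b_def nat_pow_pow dest: inj_onD)
      then show False using kl e0 by simp
    qed
  qed auto
  have sub: "(\<lambda>k. b [^] k) ` {..<n} \<subseteq> roots"
    using b aR by (auto simp: roots_def b_def nat_pow_pow pow1 e)
  have "n \<le> card roots"
    using card_mono[OF _ sub] fin inj by (simp add: roots_def card_image)
  moreover have "card roots \<le> n" unfolding roots_def using n0 num_roots_le_deg[OF fin] by simp
  ultimately have cr: "card roots = n" by simp
  define x0 where "x0 = a [^] j"
  have x0: "x0 \<in> carrier R" "x0 \<noteq> \<zero>" "x0 [^] n = c"
  proof -
    show "x0 \<in> carrier R" using aR by (simp add: x0_def)
    show "x0 [^] n = c" using aR by (simp add: x0_def i j nat_pow_pow mult.commute)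
    then show "x0 \<noteq> \<zero>" using c(2) n0 by (auto simp: nat_pow_zero)
  qed
  have inv0: "inv x0 \<in> carrier R" "inv x0 \<otimes> x0 = \<one>" "x0 \<otimes> inv x0 = \<one>"
    using x0 by (auto simp: field_Units)
  have "bij_betw (\<lambda>y. x0 \<otimes> y) roots {x \<in> carrier R. x [^] n = c}"
  proof (rule bij_betw_byWitness[where f' = "\<lambda>y. inv x0 \<otimes> y"])
    show "\<forall>y\<in>roots. inv x0 \<otimes> (x0 \<otimes> y) = y"
      using x0 inv0 by (auto simp: roots_def simp flip: m_assoc)
    show "\<forall>y\<in>{x \<in> carrier R. x [^] n = c}. x0 \<otimes> (inv x0 \<otimes> y) = y"
      using x0 inv0 by (auto simp flip: m_assoc)
    show "(\<otimes>) x0 ` roots \<subseteq> {x \<in> carrier R. x [^] n = c}"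
      using x0 c by (auto simp: roots_def nat_pow_distrib)
    have "(inv x0) [^] n \<otimes> c = \<one>"
      using x0 inv0 by (metis nat_pow_distrib nat_pow_one)
    then show "(\<otimes>) (inv x0) ` {x \<in> carrier R. x [^] n = c} \<subseteq> roots"
      using inv0 by (auto simp: roots_def nat_pow_distrib)
  qed
  from bij_betw_same_card[OF this] cr show ?thesis by simp
qed

locale quadratic_field = field R for R (structure) +
  fixes q :: nat
  assumes fin: "finite (carrier R)" and order_R: "order R = q ^ 2" and q_gt_1: "q > 1"
    and frob_add: "\<lbrakk>x \<in> carrier R; y \<in> carrier R\<rbrakk> \<Longrightarrow> (x \<oplus> y) [^] q = x [^] q \<oplus> y [^] q"
begin

definition cnj ("\<sigma>") where "\<sigma> x = x [^] q"

lemma q_pos: "q > 0" using q_gt_1 by simp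

lemma order_R_minus_1: "order R - 1 = (q - 1) * (q + 1)"
  unfolding order_R using q_pos by (cases q) (simp_all add: power2_eq_square)

lemma order_R_factors:
  "q - 1 dvd order R - 1" "(order R - 1) div (q - 1) = q + 1"
  "q + 1 dvd order R - 1" "(order R - 1) div (q + 1) = q - 1"
proof -
  have "q - 1 \<noteq> 0" using q_gt_1 by auto
  then show "(order R - 1) div (q - 1) = q + 1"
    unfolding order_R_minus_1 by (rule nonzero_mult_div_cancel_left)
  have "q + 1 \<noteq> 0" by simp
  then show "(order R - 1) div (q + 1) = q - 1"
    unfolding order_R_minus_1 by (rule nonzero_mult_div_cancel_right)
qed (simp_all only: order_R_minus_1 dvd_triv_left dvd_triv_right)

lemma cnj_closed [simp, intro]: "x \<in> carrier R \<Longrightarrow> \<sigma> x \<in> carrier R" by (simp add: cnj_def)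
lemma cnj_add [simp]: "x \<in> carrier R \<Longrightarrow> y \<in> carrier R \<Longrightarrow> \<sigma> (x \<oplus> y) = \<sigma> x \<oplus> \<sigma> y"
  by (simp add: cnj_def frob_add)
lemma cnj_mult [simp]: "x \<in> carrier R \<Longrightarrow> y \<in> carrier R \<Longrightarrow> \<sigma> (x \<otimes> y) = \<sigma> x \<otimes> \<sigma> y"
  by (simp add: cnj_def nat_pow_distrib)
lemma cnj_zero [simp]: "\<sigma> \<zero> = \<zero>" using q_pos by (simp add: cnj_def nat_pow_zero)
lemma cnj_one [simp]: "\<sigma> \<one> = \<one>" by (simp add: cnj_def)
lemma cnj_uminus [simp]: "x \<in> carrier R \<Longrightarrow> \<sigma> (\<ominus> x) = \<ominus> \<sigma> x"
  using cnj_add[of x "\<ominus> x"] by (simp add: r_neg sum_zero_eq_neg minus_equality a_comm)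
lemma cnj_minus [simp]: "x \<in> carrier R \<Longrightarrow> y \<in> carrier R \<Longrightarrow> \<sigma> (x \<ominus> y) = \<sigma> x \<ominus> \<sigma> y"
  by (simp add: a_minus_def)

lemma nat_pow_order_minus_1: "x \<in> carrier R \<Longrightarrow> x \<noteq> \<zero> \<Longrightarrow> x [^] ((q - 1) * (q + 1)) = \<one>"
proof -
  assume x: "x \<in> carrier R" "x \<noteq> \<zero>"
  interpret M: group "Multiplicative_Group.mult_of R" by (rule field_mult_group)
  have "x [^]\<^bsub>Multiplicative_Group.mult_of R\<^esub> order (Multiplicative_Group.mult_of R) = \<one>\<^bsub>Multiplicative_Group.mult_of R\<^esub>" using x by (intro M.pow_order_eq_1) auto
  then show ?thesis by (simp only: Multiplicative_Group.nat_pow_mult_of order_mult_of[OF fin] order_R_minus_1 Multiplicative_Group.one_mult_of)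
qed

lemma cnj_cnj [simp]: "x \<in> carrier R \<Longrightarrow> \<sigma> (\<sigma> x) = x"
proof (cases "x = \<zero>")
  case False
  assume x: "x \<in> carrier R"
  have "q * q = Suc ((q - 1) * (q + 1))" using q_pos by (cases q) simp_all
  then have "\<sigma> (\<sigma> x) = x [^] Suc ((q - 1) * (q + 1))" using x by (simp only: cnj_def nat_pow_pow)
  then show ?thesis by (simp only: nat_pow_Suc nat_pow_order_minus_1[OF x False] l_one[OF x])
qed simp

lemma card_cnj_eq_scalar:
  assumes c: "c \<in> carrier R" "c [^] (q + 1) = \<one>"
  shows "card {x \<in> carrier R. \<sigma> x = c \<otimes> x} = q"
proof -
  have c0: "c \<noteq> \<zero>" using c by (auto simp: nat_pow_zero)
  have q1: "q = Suc (q - 1)" using q_pos by simp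
  have eq: "\<sigma> x = c \<otimes> x \<longleftrightarrow> x [^] (q - 1) = c" if "x \<in> carrier R" "x \<noteq> \<zero>" for x
  proof -
    have "\<sigma> x = x [^] (q - 1) \<otimes> x" unfolding cnj_def using q1 nat_pow_Suc by metis
    then show ?thesis using that c by (simp add: m_rcancel)
  qed
  have "card {x \<in> carrier R. x [^] (q - 1) = c} = q - 1"
    using c c0 by (intro card_nat_pow_eq[OF fin]) (simp_all only: order_R_factors not_False_eq_True)
  moreover have "{x \<in> carrier R. \<sigma> x = c \<otimes> x} = insert \<zero> {x \<in> carrier R. x [^] (q - 1) = c}"
    (is "?A = ?B")
  proof (rule Set.set_eqI)
    fix x show "x \<in> ?A \<longleftrightarrow> x \<in> ?B"
    proof (cases "x = \<zero>")
      case True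
      then show ?thesis using c by simp
    next
      case False
      then show ?thesis using eq by blast
    qed
  qed
  moreover have "q - 1 \<noteq> 0" using q_gt_1 by simp
  then have "\<zero> [^] (q - 1) \<noteq> c" using c0 nat_pow_zero by metis
  ultimately show ?thesis using fin q_gt_1 by simp
qed

lemma card_fixed: "card {x \<in> carrier R. \<sigma> x = x} = q"
proof -
  have "{x \<in> carrier R. \<sigma> x = x} = {x \<in> carrier R. \<sigma> x = \<one> \<otimes> x}" by auto
  then show ?thesis using card_cnj_eq_scalar[of \<one>] by simp
qed

lemma card_trace_zero: "card {x \<in> carrier R. \<sigma> x = \<ominus> x} = q"
proof -
  have "(\<ominus> \<one>) [^] q = \<ominus> \<one>" using cnj_uminus[of \<one>] by (simp add: cnj_def)
  then have "(\<ominus> \<one>) [^] (q + 1) = \<one>" by (simp add: l_minus r_minus)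
  moreover have "{x \<in> carrier R. \<sigma> x = \<ominus> x} = {x \<in> carrier R. \<sigma> x = \<ominus> \<one> \<otimes> x}" by (auto simp: l_minus)
  ultimately show ?thesis using card_cnj_eq_scalar[of "\<ominus> \<one>"] by simp
qed

lemma trace_one_cnj: "w \<in> carrier R \<Longrightarrow> w \<oplus> \<sigma> w = \<one> \<Longrightarrow> \<sigma> w = \<one> \<ominus> w"
proof -
  assume w: "w \<in> carrier R" "w \<oplus> \<sigma> w = \<one>"
  have "\<sigma> w = (w \<oplus> \<sigma> w) \<ominus> w" using w(1) cnj_closed[of w] by algebra
  then show ?thesis by (simp add: w(2))
qed

text \<open>
  The product of \<open>t\<close> with an element of trace one is a particular solution; the homogeneous equation
  defines the subfield with \<open>q\<close> elements.
\<close>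

lemma card_minus_cnj_eq:
  assumes w: "w \<in> carrier R" "w \<oplus> \<sigma> w = \<one>" and t: "t \<in> carrier R" "\<sigma> t = \<ominus> t"
  shows "card {y \<in> carrier R. y \<ominus> \<sigma> y = t} = q"
proof -
  have "t \<otimes> w \<ominus> \<ominus> t \<otimes> \<sigma> w = t \<otimes> (w \<oplus> \<sigma> w)" using t(1) w(1) cnj_closed[of w] by algebra
  then have tw: "t \<otimes> w \<ominus> \<sigma> (t \<otimes> w) = t" using t w by simp
  have "bij_betw (\<lambda>y. t \<otimes> w \<oplus> y) {x \<in> carrier R. \<sigma> x = x} {y \<in> carrier R. y \<ominus> \<sigma> y = t}"
  proof (rule bij_betw_byWitness[where f' = "\<lambda>y. y \<ominus> t \<otimes> w"])
    have "t \<otimes> w \<oplus> y \<ominus> t \<otimes> w = y" if "y \<in> carrier R" for y using that t(1) w(1) by algebra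
    then show "\<forall>x\<in>{x \<in> carrier R. \<sigma> x = x}. t \<otimes> w \<oplus> x \<ominus> t \<otimes> w = x" by blast
    have "t \<otimes> w \<oplus> (y \<ominus> t \<otimes> w) = y" if "y \<in> carrier R" for y using that t(1) w(1) by algebra
    then show "\<forall>y\<in>{y \<in> carrier R. y \<ominus> \<sigma> y = t}. t \<otimes> w \<oplus> (y \<ominus> t \<otimes> w) = y" by blast
    have 1: "t \<otimes> w \<oplus> y \<ominus> \<sigma> (t \<otimes> w \<oplus> y) = t" if y: "y \<in> carrier R" "\<sigma> y = y" for y
    proof -
      have "t \<otimes> w \<oplus> y \<ominus> (\<sigma> (t \<otimes> w) \<oplus> y) = t \<otimes> w \<ominus> \<sigma> (t \<otimes> w)"
        using y(1) t(1) w(1) cnj_closed[of "t \<otimes> w"] by algebra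
      then show ?thesis using y t(1) w(1) tw by (simp del: cnj_mult)
    qed
    then show "(\<lambda>y. t \<otimes> w \<oplus> y) ` {x \<in> carrier R. \<sigma> x = x} \<subseteq> {y \<in> carrier R. y \<ominus> \<sigma> y = t}"
      using t(1) w(1) by auto
    have 2: "\<sigma> (y \<ominus> t \<otimes> w) = y \<ominus> t \<otimes> w" if y: "y \<in> carrier R" "y \<ominus> \<sigma> y = t" for y
    proof -
      have "\<sigma> y \<ominus> \<sigma> (t \<otimes> w) = y \<ominus> (y \<ominus> \<sigma> y) \<ominus> t \<otimes> w \<oplus> (t \<otimes> w \<ominus> \<sigma> (t \<otimes> w))"
        using y(1) cnj_closed[of y] t(1) w(1) cnj_closed[of "t \<otimes> w"] by algebra
      also have "\<dots> = y \<ominus> t \<ominus> t \<otimes> w \<oplus> t" by (simp only: y(2) tw)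
      also have "\<dots> = y \<ominus> t \<otimes> w" using y(1) t(1) w(1) by algebra
      finally show ?thesis using y(1) t(1) w(1) by (simp del: cnj_mult)
    qed
    then show "(\<lambda>y. y \<ominus> t \<otimes> w) ` {y \<in> carrier R. y \<ominus> \<sigma> y = t} \<subseteq> {x \<in> carrier R. \<sigma> x = x}"
      using t(1) w(1) by auto
  qed
  from bij_betw_same_card[OF this] show ?thesis by (simp add: card_fixed)
qed

text \<open>
  For nonzero \<open>c\<close> in the subfield fixed by \<open>\<sigma>\<close> the equation reads \<open>x\<^bsup>q + 1\<^esup> = c\<close>, and
  \<open>c\<^bsup>q - 1\<^esup> = 1\<close>.
\<close>

lemma card_norm_eq:
  assumes c: "c \<in> carrier R" "\<sigma> c = c"
  shows "card {x \<in> carrier R. x \<otimes> \<sigma> x = c} = (if c = \<zero> then 1 else q + 1)"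
proof (cases "c = \<zero>")
  case True
  have "x \<otimes> \<sigma> x = \<zero> \<longleftrightarrow> x = \<zero>" if "x \<in> carrier R" for x
    using that cnj_cnj[of x] by (metis cnj_zero integral_iff cnj_closed)
  then have "{x \<in> carrier R. x \<otimes> \<sigma> x = c} = {\<zero>}" using True by auto
  then show ?thesis using True by simp
next
  case False
  have "c [^] (q - 1) \<otimes> c = \<one> \<otimes> c"
    using c q_pos by (simp flip: nat_pow_Suc cnj_def)
  then have "c [^] (q - 1) = \<one>" using c False by (subst (asm) m_rcancel) auto
  then have "card {x \<in> carrier R. x [^] (q + 1) = c} = q + 1"
    using c False by (intro card_nat_pow_eq[OF fin]) (simp_all only: order_R_factors not_False_eq_True)
  moreover have "x [^] (q + 1) = x \<otimes> \<sigma> x" if "x \<in> carrier R" for x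
    using that by (simp add: cnj_def m_comm)
  ultimately show ?thesis using False by (auto cong: conj_cong)
qed

lemma card_roots_of_unity:
  assumes "m dvd q + 1"
  shows "card {u \<in> carrier R. u [^] m = \<one>} = m"
proof (rule card_nat_pow_eq[OF fin])
  show "m dvd order R - 1" using assms order_R_factors(3) by (rule dvd_trans)
qed auto

lemma roots_of_unity_cnj:
  assumes "m dvd q + 1" "u \<in> carrier R" "u [^] m = \<one>"
  shows "u \<otimes> \<sigma> u = \<one>"
proof -
  obtain r where "q + 1 = m * r" using assms(1) by (auto simp: dvd_def)
  then have "u [^] (q + 1) = \<one>" using assms by (metis nat_pow_pow nat_pow_one)
  then show ?thesis using assms by (simp add: cnj_def m_comm)
qed

end

section \<open>The Heisenberg group over a quadratic extension\<close>

context quadratic_field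
begin

definition heis :: "('a \<times> 'a) monoid" where
  "heis = \<lparr>carrier = {(a, b). a \<in> carrier R \<and> b \<in> carrier R \<and> b \<oplus> \<sigma> b \<oplus> a \<otimes> \<sigma> a = \<zero>},
     monoid.mult = (\<lambda>(a, b) (c, d). (a \<oplus> c, b \<oplus> d \<ominus> a \<otimes> \<sigma> c)), one = (\<zero>, \<zero>)\<rparr>"

lemma heis_carrier: "(a, b) \<in> carrier heis \<longleftrightarrow> a \<in> carrier R \<and> b \<in> carrier R \<and> b \<oplus> \<sigma> b \<oplus> a \<otimes> \<sigma> a = \<zero>"
  by (simp add: heis_def)
lemma heis_mult: "(a, b) \<otimes>\<^bsub>heis\<^esub> (c, d) = (a \<oplus> c, b \<oplus> d \<ominus> a \<otimes> \<sigma> c)" by (simp add: heis_def)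
lemma heis_one: "\<one>\<^bsub>heis\<^esub> = (\<zero>, \<zero>)" by (simp add: heis_def)

lemma group_heis: "group heis"
proof (rule groupI)
  fix x y assume "x \<in> carrier heis" "y \<in> carrier heis"
  moreover obtain a b c d where xy: "x = (a, b)" "y = (c, d)" by (cases x, cases y)
  ultimately have R: "a \<in> carrier R" "b \<in> carrier R" "c \<in> carrier R" "d \<in> carrier R"
    and 0: "b \<oplus> \<sigma> b \<oplus> a \<otimes> \<sigma> a = \<zero>" "d \<oplus> \<sigma> d \<oplus> c \<otimes> \<sigma> c = \<zero>" by (auto simp: heis_carrier)
  have "(b \<oplus> d \<ominus> a \<otimes> \<sigma> c) \<oplus> (\<sigma> b \<oplus> \<sigma> d \<ominus> \<sigma> a \<otimes> c) \<oplus> (a \<oplus> c) \<otimes> (\<sigma> a \<oplus> \<sigma> c)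
    = (b \<oplus> \<sigma> b \<oplus> a \<otimes> \<sigma> a) \<oplus> (d \<oplus> \<sigma> d \<oplus> c \<otimes> \<sigma> c)"
    using R cnj_closed[of a] cnj_closed[of b] cnj_closed[of c] cnj_closed[of d] by algebra
  also have "\<dots> = \<zero>" by (simp add: 0)
  finally show "x \<otimes>\<^bsub>heis\<^esub> y \<in> carrier heis" using R by (simp add: xy heis_mult heis_carrier)
next
  show "\<one>\<^bsub>heis\<^esub> \<in> carrier heis" by (simp add: heis_one heis_carrier)
next
  fix x y z assume "x \<in> carrier heis" "y \<in> carrier heis" "z \<in> carrier heis"
  moreover obtain a b c d e f where "x = (a, b)" "y = (c, d)" "z = (e, f)" by (cases x, cases y, cases z)
  moreover have "b \<oplus> d \<ominus> a \<otimes> \<sigma> c \<oplus> f \<ominus> (a \<oplus> c) \<otimes> \<sigma> e = b \<oplus> (d \<oplus> f \<ominus> c \<otimes> \<sigma> e) \<ominus> a \<otimes> (\<sigma> c \<oplus> \<sigma> e)"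
    if "a \<in> carrier R" "b \<in> carrier R" "c \<in> carrier R" "d \<in> carrier R" "e \<in> carrier R" "f \<in> carrier R"
    using that cnj_closed[of c] cnj_closed[of e] by algebra
  ultimately show "x \<otimes>\<^bsub>heis\<^esub> y \<otimes>\<^bsub>heis\<^esub> z = x \<otimes>\<^bsub>heis\<^esub> (y \<otimes>\<^bsub>heis\<^esub> z)"
    by (auto simp: heis_mult heis_carrier a_assoc)
next
  fix x assume "x \<in> carrier heis"
  moreover obtain a b where "x = (a, b)" by (cases x)
  ultimately show "\<one>\<^bsub>heis\<^esub> \<otimes>\<^bsub>heis\<^esub> x = x" by (auto simp: heis_mult heis_carrier heis_one a_minus_def)
next
  fix x assume "x \<in> carrier heis"
  moreover obtain a b where x: "x = (a, b)" by (cases x)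
  ultimately have R: "a \<in> carrier R" "b \<in> carrier R" and 0: "b \<oplus> \<sigma> b \<oplus> a \<otimes> \<sigma> a = \<zero>" by (auto simp: heis_carrier)
  have "\<sigma> b \<oplus> b \<ominus> (\<ominus> a) \<otimes> \<sigma> a = b \<oplus> \<sigma> b \<oplus> a \<otimes> \<sigma> a" using R cnj_closed[of a] cnj_closed[of b] by algebra
  moreover have "\<sigma> b \<oplus> b \<oplus> (\<ominus> a) \<otimes> (\<ominus> \<sigma> a) = b \<oplus> \<sigma> b \<oplus> a \<otimes> \<sigma> a" using R cnj_closed[of a] cnj_closed[of b] by algebra
  ultimately show "\<exists>y\<in>carrier heis. y \<otimes>\<^bsub>heis\<^esub> x = \<one>\<^bsub>heis\<^esub>"
    using R 0 by (intro bexI[of _ "(\<ominus> a, \<sigma> b)"]) (auto simp: x heis_mult heis_carrier heis_one l_neg)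
qed

lemma heis_inv: "(a, b) \<in> carrier heis \<Longrightarrow> inv\<^bsub>heis\<^esub> (a, b) = (\<ominus> a, \<sigma> b)"
proof -
  assume x: "(a, b) \<in> carrier heis"
  then have R: "a \<in> carrier R" "b \<in> carrier R" and 0: "b \<oplus> \<sigma> b \<oplus> a \<otimes> \<sigma> a = \<zero>" by (auto simp: heis_carrier)
  have "\<sigma> b \<oplus> b \<ominus> (\<ominus> a) \<otimes> \<sigma> a = b \<oplus> \<sigma> b \<oplus> a \<otimes> \<sigma> a" using R cnj_closed[of a] cnj_closed[of b] by algebra
  moreover have "\<sigma> b \<oplus> b \<oplus> (\<ominus> a) \<otimes> (\<ominus> \<sigma> a) = b \<oplus> \<sigma> b \<oplus> a \<otimes> \<sigma> a" using R cnj_closed[of a] cnj_closed[of b] by algebra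
  ultimately show ?thesis
    using R 0 x by (intro group.inv_equality[OF group_heis]) (auto simp: heis_mult heis_carrier heis_one l_neg)
qed

lemma eq_uminus_iff: "x \<in> carrier R \<Longrightarrow> y \<in> carrier R \<Longrightarrow> x = \<ominus> y \<longleftrightarrow> x \<oplus> y = \<zero>"
  using minus_equality[of x y] by (auto simp: l_neg)

lemma heis_cnj: "(A, B) \<in> carrier heis \<Longrightarrow> \<sigma> B = \<ominus> B \<ominus> A \<otimes> \<sigma> A"
proof -
  assume "(A, B) \<in> carrier heis"
  then have R: "A \<in> carrier R" "B \<in> carrier R" and 0: "B \<oplus> \<sigma> B \<oplus> A \<otimes> \<sigma> A = \<zero>"
    by (auto simp: heis_carrier)
  have "\<sigma> B = (B \<oplus> \<sigma> B \<oplus> A \<otimes> \<sigma> A) \<ominus> B \<ominus> A \<otimes> \<sigma> A"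
    using R cnj_closed[of A] cnj_closed[of B] by algebra
  then show ?thesis using R by (simp add: 0 a_minus_def)
qed

lemma finite_heis: "finite (carrier heis)"
  by (rule finite_subset[of _ "carrier R \<times> carrier R"]) (auto simp: heis_def fin)

lemma heis_quotient:
  assumes "(A, B) \<in> carrier heis" "(a, b) \<in> carrier heis"
  shows "(A, B) \<otimes>\<^bsub>heis\<^esub> inv\<^bsub>heis\<^esub> (a, b) = (A \<ominus> a, B \<oplus> \<sigma> b \<oplus> A \<otimes> \<sigma> a)"
proof -
  have R: "a \<in> carrier R" "b \<in> carrier R" "A \<in> carrier R" "B \<in> carrier R"
    using assms by (auto simp: heis_carrier)
  have "B \<oplus> \<sigma> b \<ominus> A \<otimes> (\<ominus> \<sigma> a) = B \<oplus> \<sigma> b \<oplus> A \<otimes> \<sigma> a"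
    using R cnj_closed[of a] cnj_closed[of b] by algebra
  then show ?thesis using R by (simp add: heis_inv[OF assms(2)] heis_mult a_minus_def)
qed

text \<open>
  For \<open>w\<close> of trace one this is a transversal of the centre: it contains one element over each \<open>a\<close>.
\<close>

definition slice where "slice w = {(a, \<ominus> (a \<otimes> \<sigma> a \<otimes> w)) | a. a \<in> carrier R}"
definition centre where "centre = {(\<zero>, z) | z. z \<in> carrier R \<and> \<sigma> z = \<ominus> z}"

lemma slice_mem: "(a, b) \<in> slice w \<longleftrightarrow> a \<in> carrier R \<and> b = \<ominus> (a \<otimes> \<sigma> a \<otimes> w)"
  by (auto simp: slice_def)
lemma centre_mem: "(a, b) \<in> centre \<longleftrightarrow> a = \<zero> \<and> b \<in> carrier R \<and> \<sigma> b = \<ominus> b"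
  by (auto simp: centre_def)

lemma slice_subset:
  assumes w: "w \<in> carrier R" "w \<oplus> \<sigma> w = \<one>"
  shows "slice w \<subseteq> carrier heis"
proof
  fix x assume "x \<in> slice w"
  then obtain a where a: "a \<in> carrier R" "x = (a, \<ominus> (a \<otimes> \<sigma> a \<otimes> w))" by (auto simp: slice_def)
  have "\<ominus> (a \<otimes> \<sigma> a \<otimes> w) \<oplus> \<ominus> (\<sigma> a \<otimes> a \<otimes> \<sigma> w) \<oplus> a \<otimes> \<sigma> a = \<ominus> (a \<otimes> \<sigma> a \<otimes> (w \<oplus> \<sigma> w)) \<oplus> a \<otimes> \<sigma> a"
    using a(1) w(1) cnj_closed[of a] cnj_closed[of w] by algebra
  then show "x \<in> carrier heis" using a w by (simp add: heis_carrier l_neg)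
qed

lemma centre_subset: "centre \<subseteq> carrier heis"
  by (auto simp: centre_def heis_carrier r_neg)

lemma card_heis:
  assumes w: "w \<in> carrier R" "w \<oplus> \<sigma> w = \<one>"
  shows "order heis = q ^ 3"
proof -
  have "bij_betw (\<lambda>(a, z). (a, z \<ominus> a \<otimes> \<sigma> a \<otimes> w)) (carrier R \<times> {z \<in> carrier R. \<sigma> z = \<ominus> z}) (carrier heis)"
  proof (rule bij_betw_byWitness[where f' = "\<lambda>(a, b). (a, b \<oplus> a \<otimes> \<sigma> a \<otimes> w)"])
    have "z \<ominus> a \<otimes> \<sigma> a \<otimes> w \<oplus> a \<otimes> \<sigma> a \<otimes> w = z" if "a \<in> carrier R" "z \<in> carrier R" for a z
      using that w(1) cnj_closed[of a] by algebra
    then show "\<forall>x\<in>carrier R \<times> {z \<in> carrier R. \<sigma> z = \<ominus> z}.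
       (\<lambda>(a, b). (a, b \<oplus> a \<otimes> \<sigma> a \<otimes> w)) ((\<lambda>(a, z). (a, z \<ominus> a \<otimes> \<sigma> a \<otimes> w)) x) = x" by auto
    have "b \<oplus> a \<otimes> \<sigma> a \<otimes> w \<ominus> a \<otimes> \<sigma> a \<otimes> w = b" if "a \<in> carrier R" "b \<in> carrier R" for a b
      using that w(1) cnj_closed[of a] by algebra
    then show "\<forall>x\<in>carrier heis. (\<lambda>(a, z). (a, z \<ominus> a \<otimes> \<sigma> a \<otimes> w)) ((\<lambda>(a, b). (a, b \<oplus> a \<otimes> \<sigma> a \<otimes> w)) x) = x"
      by (auto simp: heis_carrier)
    have "(a, z \<ominus> a \<otimes> \<sigma> a \<otimes> w) \<in> carrier heis" if "a \<in> carrier R" "z \<in> carrier R" "\<sigma> z = \<ominus> z" for a z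
    proof -
      have "(z \<ominus> a \<otimes> \<sigma> a \<otimes> w) \<oplus> (\<ominus> z \<ominus> \<sigma> a \<otimes> a \<otimes> \<sigma> w) \<oplus> a \<otimes> \<sigma> a = \<ominus> (a \<otimes> \<sigma> a \<otimes> (w \<oplus> \<sigma> w)) \<oplus> a \<otimes> \<sigma> a"
        using that(1,2) w(1) cnj_closed[of a] cnj_closed[of w] by algebra
      then show ?thesis using that w by (simp add: heis_carrier l_neg)
    qed
    then show "(\<lambda>(a, z). (a, z \<ominus> a \<otimes> \<sigma> a \<otimes> w)) ` (carrier R \<times> {z \<in> carrier R. \<sigma> z = \<ominus> z}) \<subseteq> carrier heis" by auto
    have "\<sigma> b \<oplus> \<sigma> a \<otimes> a \<otimes> \<sigma> w = \<ominus> (b \<oplus> a \<otimes> \<sigma> a \<otimes> w)" if x: "(a, b) \<in> carrier heis" for a b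
    proof -
      have R: "a \<in> carrier R" "b \<in> carrier R" and 0: "b \<oplus> \<sigma> b \<oplus> a \<otimes> \<sigma> a = \<zero>" using x by (auto simp: heis_carrier)
      have "(\<sigma> b \<oplus> \<sigma> a \<otimes> a \<otimes> \<sigma> w) \<oplus> (b \<oplus> a \<otimes> \<sigma> a \<otimes> w) = (b \<oplus> \<sigma> b \<oplus> a \<otimes> \<sigma> a) \<ominus> a \<otimes> \<sigma> a \<oplus> a \<otimes> \<sigma> a \<otimes> (w \<oplus> \<sigma> w)"
        using R w(1) cnj_closed[of a] cnj_closed[of b] cnj_closed[of w] by algebra
      also have "\<dots> = \<zero>" using R w by (simp add: 0 a_minus_def l_neg)
      finally show ?thesis using R w by (intro minus_equality[symmetric]) auto
    qed
    then show "(\<lambda>(a, b). (a, b \<oplus> a \<otimes> \<sigma> a \<otimes> w)) ` carrier heis \<subseteq> carrier R \<times> {z \<in> carrier R. \<sigma> z = \<ominus> z}"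
      using w by (auto simp: heis_carrier)
  qed
  from bij_betw_same_card[OF this] have "order heis = order R * q"
    by (simp add: order_def card_cartesian_product card_trace_zero)
  then show ?thesis by (simp add: order_R power2_eq_square power3_eq_cube)
qed

lemma quotient_slice_iff:
  assumes w: "w \<in> carrier R" "w \<oplus> \<sigma> w = \<one>" and AB: "(A, B) \<in> carrier heis" and a: "a \<in> carrier R"
  shows "(A, B) \<otimes>\<^bsub>heis\<^esub> inv\<^bsub>heis\<^esub> (a, \<ominus> (a \<otimes> \<sigma> a \<otimes> w)) = (A \<ominus> a, B \<ominus> a \<otimes> \<sigma> a \<otimes> \<sigma> w \<oplus> A \<otimes> \<sigma> a)"
proof -
  have R: "A \<in> carrier R" "B \<in> carrier R" using AB by (auto simp: heis_carrier)
  have "(a, \<ominus> (a \<otimes> \<sigma> a \<otimes> w)) \<in> carrier heis" using slice_subset[OF w] a by (auto simp: slice_def)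
  from heis_quotient[OF AB this] show ?thesis
    using a w R by (simp add: a_minus_def m_comm)
qed

section \<open>Slopes of elements of norm one\<close>

text \<open>
  The elements of trace one correspond to the elements \<open>u \<noteq> 1\<close> of norm one by \<open>u = - \<sigma>(w) / w\<close>; this is
  the inverse of that correspondence.
\<close>

definition slope where "slope u = inv (\<one> \<ominus> u)"

context
  fixes u
  assumes u: "u \<in> carrier R" "u \<otimes> \<sigma> u = \<one>" "u \<noteq> \<one>"
begin

lemma slope_closed: "slope u \<in> carrier R" and slope_eq: "(\<one> \<ominus> u) \<otimes> slope u = \<one>"
proof -
  have "\<one> \<ominus> u \<in> Units R" using u by (auto simp: field_Units)
  then show "slope u \<in> carrier R" "(\<one> \<ominus> u) \<otimes> slope u = \<one>" by (auto simp: slope_def)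
qed

lemma slope_nonzero: "slope u \<noteq> \<zero>"
  using slope_eq u by auto

lemma u_mult_slope: "u \<otimes> slope u = slope u \<ominus> \<one>"
proof -
  have "u \<otimes> slope u = slope u \<ominus> (\<one> \<ominus> u) \<otimes> slope u" using u(1) slope_closed by algebra
  then show ?thesis by (simp add: slope_eq)
qed

lemma cnj_slope_eq: "(\<one> \<ominus> \<sigma> u) \<otimes> \<sigma> (slope u) = \<one>"
proof -
  have "\<sigma> ((\<one> \<ominus> u) \<otimes> slope u) = \<one>" by (simp only: slope_eq cnj_one)
  then show ?thesis using u(1) slope_closed by simp
qed

lemma slope_trace: "slope u \<oplus> \<sigma> (slope u) = \<one>"
proof -
  let ?s = "slope u" and ?t = "\<sigma> (slope u)"
  have c: "u \<in> carrier R" "\<sigma> u \<in> carrier R" "?s \<in> carrier R" "?t \<in> carrier R" using u(1) slope_closed by auto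
  have "u \<otimes> ((\<one> \<ominus> \<sigma> u) \<otimes> ?t) = u \<otimes> ?t \<ominus> (u \<otimes> \<sigma> u) \<otimes> ?t" using c by algebra
  then have e: "u \<otimes> ?t \<ominus> ?t = u" using c by (simp add: cnj_slope_eq u(2))
  have "(\<one> \<ominus> u) \<otimes> (?s \<oplus> ?t) = (\<one> \<ominus> u) \<otimes> ?s \<ominus> (u \<otimes> ?t \<ominus> ?t)" using c by algebra
  also have "\<dots> = (\<one> \<ominus> u) \<otimes> \<one>" using c by (simp add: slope_eq e)
  finally show ?thesis using c u(3) by (subst (asm) m_lcancel) auto
qed

lemma slope_cnj: "slope (\<sigma> u) = \<sigma> (slope u)"
  unfolding slope_def[of "\<sigma> u"] using u(1) slope_closed cnj_slope_eq
  by (intro comm_inv_char) auto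

end

lemma slope_inj:
  assumes u: "u \<in> carrier R" "u \<noteq> \<one>" and v: "v \<in> carrier R" "v \<noteq> \<one>" and eq: "slope u = slope v"
  shows "u = v"
proof -
  have U: "\<one> \<ominus> u \<in> Units R" "\<one> \<ominus> v \<in> Units R" using u v by (auto simp: field_Units)
  then have "\<one> \<ominus> u = \<one> \<ominus> v" using eq unfolding slope_def by (metis Units_inv_inv)
  moreover have "u = \<one> \<ominus> (\<one> \<ominus> u)" "v = \<one> \<ominus> (\<one> \<ominus> v)" using u v by algebra+
  ultimately show ?thesis by simp
qed

lemma slope_mult:
  assumes u: "u \<in> carrier R" "u \<otimes> \<sigma> u = \<one>" "u \<noteq> \<one>" and v: "v \<in> carrier R" "v \<otimes> \<sigma> v = \<one>" "v \<noteq> \<one>"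
  shows "(\<one> \<ominus> u \<otimes> v) \<otimes> (slope u \<otimes> slope v) = \<ominus> (\<one> \<ominus> slope u \<ominus> slope v)"
proof -
  note c = u(1) v(1) slope_closed[OF u] slope_closed[OF v]
  have "(\<one> \<ominus> u \<otimes> v) \<otimes> (slope u \<otimes> slope v) = slope u \<otimes> slope v \<ominus> (u \<otimes> slope u) \<otimes> (v \<otimes> slope v)"
    using c by algebra
  also have "\<dots> = slope u \<otimes> slope v \<ominus> (slope u \<ominus> \<one>) \<otimes> (slope v \<ominus> \<one>)"
    by (simp only: u_mult_slope[OF u] u_mult_slope[OF v])
  also have "\<dots> = \<ominus> (\<one> \<ominus> slope u \<ominus> slope v)" using c by algebra
  finally show ?thesis .
qed

text \<open>
  This identifies the slope of \<open>u v\<close> in terms of the slopes of \<open>u\<close> and \<open>v\<close>.  It is what makes the product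
  of two slices single out the slice of the product.
\<close>

lemma slope_mult_nontrivial:
  assumes u: "u \<in> carrier R" "u \<otimes> \<sigma> u = \<one>" "u \<noteq> \<one>" and v: "v \<in> carrier R" "v \<otimes> \<sigma> v = \<one>" "v \<noteq> \<one>"
    and uv: "u \<otimes> v \<noteq> \<one>"
  shows "\<one> \<ominus> slope u \<ominus> slope v \<noteq> \<zero>"
    and "(\<one> \<ominus> slope u \<ominus> slope v) \<otimes> slope (u \<otimes> v) = \<ominus> (slope u \<otimes> slope v)"
proof -
  note c = u(1) v(1) slope_closed[OF u] slope_closed[OF v]
  have "\<one> \<ominus> u \<otimes> v \<noteq> \<zero>" using c uv by simp
  then have "(\<one> \<ominus> u \<otimes> v) \<otimes> (slope u \<otimes> slope v) \<noteq> \<zero>"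
    using c slope_nonzero[OF u] slope_nonzero[OF v] by (simp add: integral_iff)
  then show "\<one> \<ominus> slope u \<ominus> slope v \<noteq> \<zero>" unfolding slope_mult[OF u v] by auto
  have "(u \<otimes> v) \<otimes> \<sigma> (u \<otimes> v) = (u \<otimes> \<sigma> u) \<otimes> (v \<otimes> \<sigma> v)" using c by (simp add: m_ac)
  then have n: "u \<otimes> v \<in> carrier R" "(u \<otimes> v) \<otimes> \<sigma> (u \<otimes> v) = \<one>" using u v by auto
  note t = slope_closed[OF n uv] slope_eq[OF n uv]
  have "(\<one> \<ominus> slope u \<ominus> slope v) \<otimes> slope (u \<otimes> v) = \<ominus> ((\<ominus> (\<one> \<ominus> slope u \<ominus> slope v)) \<otimes> slope (u \<otimes> v))"
    using c t(1) by algebra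
  also have "\<dots> = \<ominus> (((\<one> \<ominus> u \<otimes> v) \<otimes> (slope u \<otimes> slope v)) \<otimes> slope (u \<otimes> v))"
    by (simp only: slope_mult[OF u v])
  also have "\<dots> = \<ominus> (((\<one> \<ominus> u \<otimes> v) \<otimes> slope (u \<otimes> v)) \<otimes> (slope u \<otimes> slope v))"
    using c t(1) by algebra
  finally show "(\<one> \<ominus> slope u \<ominus> slope v) \<otimes> slope (u \<otimes> v) = \<ominus> (slope u \<otimes> slope v)"
    using c by (simp add: t(2))
qed

lemma slope_mult_trivial:
  assumes u: "u \<in> carrier R" "u \<otimes> \<sigma> u = \<one>" "u \<noteq> \<one>" and v: "v \<in> carrier R" "v \<otimes> \<sigma> v = \<one>" "v \<noteq> \<one>"
    and uv: "u \<otimes> v = \<one>"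
  shows "\<one> \<ominus> slope u \<ominus> slope v = \<zero>"
proof -
  note c = u(1) v(1) slope_closed[OF u] slope_closed[OF v]
  have "\<one> \<ominus> slope u \<ominus> slope v = \<ominus> ((\<one> \<ominus> u \<otimes> v) \<otimes> (slope u \<otimes> slope v))"
    unfolding slope_mult[OF u v] using c by algebra
  also have "\<dots> = \<ominus> ((\<one> \<ominus> \<one>) \<otimes> (slope u \<otimes> slope v))" by (simp only: uv)
  also have "\<dots> = \<zero>" using c by algebra
  finally show ?thesis .
qed

section \<open>Products of slices and of the centre\<close>

text \<open>
  A slice is parametrised by its first coordinate \<open>a\<close>, and whether the quotient lies in the other slice is
  one equation in \<open>a\<close>, because the first coordinate of the quotient is \<open>A - a\<close>.
\<close>

lemma card_slice_quotients:
  assumes w: "w \<in> carrier R" "w \<oplus> \<sigma> w = \<one>" and v: "v \<in> carrier R" "v \<oplus> \<sigma> v = \<one>" and AB: "(A, B) \<in> carrier heis"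
  shows "card {y \<in> slice w. (A, B) \<otimes>\<^bsub>heis\<^esub> inv\<^bsub>heis\<^esub> y \<in> slice v} =
    card {a \<in> carrier R. (B \<ominus> a \<otimes> \<sigma> a \<otimes> \<sigma> w \<oplus> A \<otimes> \<sigma> a) \<oplus> (A \<ominus> a) \<otimes> (\<sigma> A \<ominus> \<sigma> a) \<otimes> v = \<zero>}"
    (is "card ?L = card ?R")
proof -
  have R: "A \<in> carrier R" "B \<in> carrier R" using AB by (auto simp: heis_carrier)
  have iff: "(A, B) \<otimes>\<^bsub>heis\<^esub> inv\<^bsub>heis\<^esub> (a, \<ominus> (a \<otimes> \<sigma> a \<otimes> w)) \<in> slice v \<longleftrightarrow>
     (B \<ominus> a \<otimes> \<sigma> a \<otimes> \<sigma> w \<oplus> A \<otimes> \<sigma> a) \<oplus> (A \<ominus> a) \<otimes> (\<sigma> A \<ominus> \<sigma> a) \<otimes> v = \<zero>" (is "_ \<longleftrightarrow> ?e \<oplus> ?f = \<zero>")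
    if a: "a \<in> carrier R" for a
  proof -
    have c: "?e \<in> carrier R" "?f \<in> carrier R" using a R w v by auto
    have "?e = \<ominus> ?f \<longleftrightarrow> ?e \<oplus> ?f = \<zero>"
      using c by (rule eq_uminus_iff)
    then show ?thesis
      using a R v unfolding quotient_slice_iff[OF w AB a] by (simp add: slice_mem)
  qed
  have "?L = (\<lambda>a. (a, \<ominus> (a \<otimes> \<sigma> a \<otimes> w))) ` ?R" using iff by (auto simp: slice_def)
  then show ?thesis by (simp add: card_image inj_on_def)
qed

text \<open>
  With \<open>d = 1 - w - v\<close>, which satisfies \<open>\<sigma>(d) = - d\<close>, multiplying the equation for \<open>a\<close> by \<open>d\<close> completes
  the square: it becomes \<open>N (d a - \<sigma>(v) A) = c\<close> with \<open>c = - d (B + N A t)\<close>.  So there are \<open>q + 1\<close>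
  solutions, except that there is only one if \<open>c = 0\<close>, which means that \<open>(A, B)\<close> is in the slice of \<open>t\<close>.
\<close>

lemma quotient_count_slices:
  assumes w: "w \<in> carrier R" "w \<oplus> \<sigma> w = \<one>" and v: "v \<in> carrier R" "v \<oplus> \<sigma> v = \<one>"
    and d: "\<one> \<ominus> w \<ominus> v \<noteq> \<zero>" and t: "t \<in> carrier R" "(\<one> \<ominus> w \<ominus> v) \<otimes> t = \<ominus> (w \<otimes> v)"
    and x: "x \<in> carrier heis"
  shows "quotient_count heis (slice v) (slice w) x = int q + 1 - int q * indicator (slice t) x"
proof -
  obtain A B where AB: "x = (A, B)" by (cases x)
  have R: "A \<in> carrier R" "B \<in> carrier R" and 0: "B \<oplus> \<sigma> B \<oplus> A \<otimes> \<sigma> A = \<zero>" using x AB by (auto simp: heis_carrier)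
  note swv = trace_one_cnj[OF w] trace_one_cnj[OF v]
  define d where "d = \<one> \<ominus> w \<ominus> v"
  have d: "d \<in> carrier R" "d \<noteq> \<zero>" "d \<otimes> t = \<ominus> (w \<otimes> v)" using d t w v by (auto simp: d_def)
  have "\<one> \<ominus> (\<one> \<ominus> w) \<ominus> (\<one> \<ominus> v) = \<ominus> (\<one> \<ominus> w \<ominus> v)" using w(1) v(1) by algebra
  then have sd: "\<sigma> d = \<ominus> d" using w v by (simp add: d_def swv)
  define c where "c = \<ominus> (d \<otimes> B) \<oplus> A \<otimes> \<sigma> A \<otimes> (w \<otimes> v)"
  have c: "c \<in> carrier R" using R w v d by (simp add: c_def)
  have "c = \<ominus> (d \<otimes> B) \<ominus> A \<otimes> \<sigma> A \<otimes> (\<ominus> (w \<otimes> v))"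
    unfolding c_def using R w(1) v(1) d(1) cnj_closed[of A] by algebra
  also have "\<dots> = \<ominus> (d \<otimes> (B \<oplus> A \<otimes> \<sigma> A \<otimes> t))"
    unfolding d(3)[symmetric] using R t(1) d(1) cnj_closed[of A] by algebra
  finally have ct: "c = \<ominus> (d \<otimes> (B \<oplus> A \<otimes> \<sigma> A \<otimes> t))" .
  have "c = \<zero> \<longleftrightarrow> B \<oplus> A \<otimes> \<sigma> A \<otimes> t = \<zero>"
    unfolding ct using R t(1) d by (simp add: integral_iff)
  also have "\<dots> \<longleftrightarrow> B = \<ominus> (A \<otimes> \<sigma> A \<otimes> t)"
    using R t(1) by (intro eq_uminus_iff[symmetric]) auto
  finally have c0: "c = \<zero> \<longleftrightarrow> x \<in> slice t" using R by (simp add: AB slice_mem)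
  note sB = heis_cnj[OF x[unfolded AB]]
  have "\<ominus> (\<ominus> d \<otimes> (\<ominus> B \<ominus> A \<otimes> \<sigma> A)) \<oplus> \<sigma> A \<otimes> A \<otimes> ((\<one> \<ominus> w) \<otimes> (\<one> \<ominus> v)) = c"
    unfolding c_def d_def using R w(1) v(1) cnj_closed[of A] by algebra
  then have sc: "\<sigma> c = c" using R w v d by (simp add: c_def sd swv sB)
  have iff: "(B \<ominus> a \<otimes> \<sigma> a \<otimes> \<sigma> w \<oplus> A \<otimes> \<sigma> a) \<oplus> (A \<ominus> a) \<otimes> (\<sigma> A \<ominus> \<sigma> a) \<otimes> v = \<zero> \<longleftrightarrow>
     (d \<otimes> a \<ominus> \<sigma> v \<otimes> A) \<otimes> \<sigma> (d \<otimes> a \<ominus> \<sigma> v \<otimes> A) = c" (is "?e = \<zero> \<longleftrightarrow> ?n = c") if a: "a \<in> carrier R" for a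
  proof -
    have e: "?e \<in> carrier R" using a R w v by auto
    \<comment> \<open>The identity is checked with \<open>w\<close> eliminated in favour of \<open>d\<close>, which keeps the polynomials small.\<close>
    have "(d \<otimes> a \<ominus> (\<one> \<ominus> v) \<otimes> A) \<otimes> (\<ominus> d \<otimes> \<sigma> a \<ominus> v \<otimes> \<sigma> A) \<ominus>
          (\<ominus> (d \<otimes> B) \<oplus> A \<otimes> \<sigma> A \<otimes> ((\<one> \<ominus> v \<ominus> d) \<otimes> v)) =
      d \<otimes> ((B \<ominus> a \<otimes> \<sigma> a \<otimes> (v \<oplus> d) \<oplus> A \<otimes> \<sigma> a) \<oplus> (A \<ominus> a) \<otimes> (\<sigma> A \<ominus> \<sigma> a) \<otimes> v)"
      using a R v(1) d(1) cnj_closed[of A] cnj_closed[of a] by algebra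
    moreover have "w = \<one> \<ominus> v \<ominus> d" "\<one> \<ominus> w = v \<oplus> d" unfolding d_def using w(1) v(1) by algebra+
    ultimately have "(d \<otimes> a \<ominus> (\<one> \<ominus> v) \<otimes> A) \<otimes> (\<ominus> d \<otimes> \<sigma> a \<ominus> v \<otimes> \<sigma> A) \<ominus> c =
      d \<otimes> ((B \<ominus> a \<otimes> \<sigma> a \<otimes> (\<one> \<ominus> w) \<oplus> A \<otimes> \<sigma> a) \<oplus> (A \<ominus> a) \<otimes> (\<sigma> A \<ominus> \<sigma> a) \<otimes> v)"
      unfolding c_def by (simp only:)
    moreover have "\<sigma> (d \<otimes> a \<ominus> \<sigma> v \<otimes> A) = \<ominus> d \<otimes> \<sigma> a \<ominus> v \<otimes> \<sigma> A"
      using a R v d by (simp add: sd)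
    ultimately have "?n \<ominus> c = d \<otimes> ?e" by (simp add: swv)
    moreover have "?n \<in> carrier R" using a R v d by simp
    ultimately show ?thesis using e d c by (metis integral_iff r_right_minus_eq)
  qed
  have dU: "inv d \<in> carrier R" "inv d \<otimes> d = \<one>" "d \<otimes> inv d = \<one>" using d by (auto simp: field_Units)
  have "bij_betw (\<lambda>a. d \<otimes> a \<ominus> \<sigma> v \<otimes> A)
     {a \<in> carrier R. (B \<ominus> a \<otimes> \<sigma> a \<otimes> \<sigma> w \<oplus> A \<otimes> \<sigma> a) \<oplus> (A \<ominus> a) \<otimes> (\<sigma> A \<ominus> \<sigma> a) \<otimes> v = \<zero>} {z \<in> carrier R. z \<otimes> \<sigma> z = c}"
    (is "bij_betw ?f ?X ?Z")
  proof (rule bij_betw_byWitness[where f' = "\<lambda>z. inv d \<otimes> (z \<oplus> \<sigma> v \<otimes> A)"])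
    have 1: "inv d \<otimes> (d \<otimes> a \<ominus> \<sigma> v \<otimes> A \<oplus> \<sigma> v \<otimes> A) = a" if "a \<in> carrier R" for a
    proof -
      have "inv d \<otimes> (d \<otimes> a \<ominus> \<sigma> v \<otimes> A \<oplus> \<sigma> v \<otimes> A) = (inv d \<otimes> d) \<otimes> a"
        using that R v(1) cnj_closed[of v] d(1) dU(1) by algebra
      then show ?thesis using that dU by simp
    qed
    then show "\<forall>a\<in>?X. inv d \<otimes> (?f a \<oplus> \<sigma> v \<otimes> A) = a" by blast
    have 2: "d \<otimes> (inv d \<otimes> (z \<oplus> \<sigma> v \<otimes> A)) \<ominus> \<sigma> v \<otimes> A = z" if "z \<in> carrier R" for z
    proof -
      have "d \<otimes> (inv d \<otimes> (z \<oplus> \<sigma> v \<otimes> A)) \<ominus> \<sigma> v \<otimes> A = (d \<otimes> inv d) \<otimes> (z \<oplus> \<sigma> v \<otimes> A) \<ominus> \<sigma> v \<otimes> A"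
        using that R v(1) cnj_closed[of v] d(1) dU(1) by algebra
      also have "\<dots> = z \<oplus> \<sigma> v \<otimes> A \<ominus> \<sigma> v \<otimes> A" using that R v dU by simp
      also have "\<dots> = z" using that R v(1) cnj_closed[of v] by algebra
      finally show ?thesis .
    qed
    then show "\<forall>z\<in>?Z. ?f (inv d \<otimes> (z \<oplus> \<sigma> v \<otimes> A)) = z" by blast
    show "?f ` ?X \<subseteq> ?Z"
    proof (rule image_subsetI)
      fix a assume "a \<in> ?X"
      then show "?f a \<in> ?Z" using iff[of a] R v d by simp
    qed
    show "(\<lambda>z. inv d \<otimes> (z \<oplus> \<sigma> v \<otimes> A)) ` ?Z \<subseteq> ?X"
    proof (rule image_subsetI)
      fix z assume z: "z \<in> ?Z"
      have "inv d \<otimes> (z \<oplus> \<sigma> v \<otimes> A) \<in> carrier R" using z R v dU by simp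
      from iff[OF this] show "inv d \<otimes> (z \<oplus> \<sigma> v \<otimes> A) \<in> ?X"
        using z 2[of z] \<open>inv d \<otimes> (z \<oplus> \<sigma> v \<otimes> A) \<in> carrier R\<close> by simp
    qed
  qed
  from bij_betw_same_card[OF this] have "card ?X = (if c = \<zero> then 1 else q + 1)"
    using card_norm_eq[OF c sc] by simp
  then show ?thesis
    using card_slice_quotients[OF w v, of A B] x c0 by (simp add: quotient_count_def AB)
qed

text \<open>
  Here \<open>v = \<sigma>(w)\<close>, the quadratic terms cancel, and the equation for \<open>a\<close> becomes \<open>y - \<sigma>(y) = t\<close> for
  \<open>y = v \<sigma>(A) a\<close> and an element \<open>t\<close> of trace zero.  If \<open>A \<noteq> 0\<close> there are \<open>q\<close> solutions; if \<open>A = 0\<close> the left-hand side vanishes and \<open>t = B\<close>.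
\<close>

lemma quotient_count_complementary_slices:
  assumes w: "w \<in> carrier R" "w \<oplus> \<sigma> w = \<one>" and v: "v \<in> carrier R" "v \<oplus> \<sigma> v = \<one>" "v \<noteq> \<zero>"
    and d: "\<one> \<ominus> w \<ominus> v = \<zero>" and x: "x \<in> carrier heis"
  shows "quotient_count heis (slice v) (slice w) x =
    int q ^ 2 * indicator {\<one>\<^bsub>heis\<^esub>} x + int q * (1 - indicator centre x)"
proof -
  obtain A B where AB: "x = (A, B)" by (cases x)
  have R: "A \<in> carrier R" "B \<in> carrier R" and 0: "B \<oplus> \<sigma> B \<oplus> A \<otimes> \<sigma> A = \<zero>" using x AB by (auto simp: heis_carrier)
  have "\<one> \<ominus> w = (\<one> \<ominus> w \<ominus> v) \<oplus> v" using w(1) v(1) by algebra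
  then have sw: "\<sigma> w = v" using trace_one_cnj[OF w] v(1) by (simp add: d)
  have sv: "\<sigma> v = \<one> \<ominus> v" using trace_one_cnj[OF v(1,2)] .
  note sB = heis_cnj[OF x[unfolded AB]]
  define t where "t = B \<oplus> A \<otimes> \<sigma> A \<otimes> v"
  have t: "t \<in> carrier R" using R v by (simp add: t_def)
  have "\<ominus> B \<ominus> A \<otimes> \<sigma> A \<oplus> \<sigma> A \<otimes> A \<otimes> (\<one> \<ominus> v) = \<ominus> t"
    unfolding t_def using R v(1) cnj_closed[of A] by algebra
  then have st: "\<sigma> t = \<ominus> t" using R v by (simp add: t_def sB sv)
  have iff: "(B \<ominus> a \<otimes> \<sigma> a \<otimes> \<sigma> w \<oplus> A \<otimes> \<sigma> a) \<oplus> (A \<ominus> a) \<otimes> (\<sigma> A \<ominus> \<sigma> a) \<otimes> v = \<zero> \<longleftrightarrow>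
     (v \<otimes> \<sigma> A) \<otimes> a \<ominus> \<sigma> ((v \<otimes> \<sigma> A) \<otimes> a) = t" (is "?e = \<zero> \<longleftrightarrow> ?y = t") if a: "a \<in> carrier R" for a
  proof -
    have "t \<ominus> ((v \<otimes> \<sigma> A) \<otimes> a \<ominus> ((\<one> \<ominus> v) \<otimes> A) \<otimes> \<sigma> a) =
      (B \<ominus> a \<otimes> \<sigma> a \<otimes> v \<oplus> A \<otimes> \<sigma> a) \<oplus> (A \<ominus> a) \<otimes> (\<sigma> A \<ominus> \<sigma> a) \<otimes> v"
      unfolding t_def using a R v(1) cnj_closed[of A] cnj_closed[of a] by algebra
    then have "t \<ominus> ?y = ?e" using a R v by (simp add: sv sw)
    moreover have "?y \<in> carrier R" using a R v by simp
    ultimately show ?thesis using t by (metis r_right_minus_eq)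
  qed
  have count: "card {y \<in> slice w. (A, B) \<otimes>\<^bsub>heis\<^esub> inv\<^bsub>heis\<^esub> y \<in> slice v} =
      card {a \<in> carrier R. (v \<otimes> \<sigma> A) \<otimes> a \<ominus> \<sigma> ((v \<otimes> \<sigma> A) \<otimes> a) = t}"
    using card_slice_quotients[OF w v(1,2), of A B] x iff by (auto simp: AB cong: conj_cong)
  show ?thesis
  proof (cases "A = \<zero>")
    case True
    then have "t = B" using R v by (simp add: t_def)
    then have "{a \<in> carrier R. (v \<otimes> \<sigma> A) \<otimes> a \<ominus> \<sigma> ((v \<otimes> \<sigma> A) \<otimes> a) = t} = (if B = \<zero> then carrier R else {})"
      using True v by (auto simp: a_minus_def)
    moreover have "\<sigma> B = \<ominus> B" using sB R True by (simp add: a_minus_def)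
    ultimately show ?thesis
      using count order_R True R
      by (simp add: quotient_count_def AB heis_one centre_mem order_def indicator_def)
  next
    case False
    define c where "c = v \<otimes> \<sigma> A"
    have "\<sigma> A \<noteq> \<zero>" using False R by (metis cnj_cnj cnj_zero)
    then have c: "c \<in> carrier R" "c \<noteq> \<zero>" using R v by (auto simp: c_def integral_iff)
    then have cU: "inv c \<in> carrier R" "inv c \<otimes> c = \<one>" "c \<otimes> inv c = \<one>" by (auto simp: field_Units)
    have "bij_betw (\<lambda>a. c \<otimes> a) {a \<in> carrier R. c \<otimes> a \<ominus> \<sigma> (c \<otimes> a) = t} {y \<in> carrier R. y \<ominus> \<sigma> y = t}"
    proof (rule bij_betw_byWitness[where f' = "\<lambda>y. inv c \<otimes> y"])
      have 1: "c \<otimes> (inv c \<otimes> y) = y" if "y \<in> carrier R" for y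
        using that c cU by (simp flip: m_assoc)
      show "\<forall>a\<in>{a \<in> carrier R. c \<otimes> a \<ominus> \<sigma> (c \<otimes> a) = t}. inv c \<otimes> (c \<otimes> a) = a"
        using c cU by (simp flip: m_assoc)
      show "\<forall>y\<in>{y \<in> carrier R. y \<ominus> \<sigma> y = t}. c \<otimes> (inv c \<otimes> y) = y" using 1 by blast
      show "(\<otimes>) c ` {a \<in> carrier R. c \<otimes> a \<ominus> \<sigma> (c \<otimes> a) = t} \<subseteq> {y \<in> carrier R. y \<ominus> \<sigma> y = t}" using c by auto
      show "(\<otimes>) (inv c) ` {y \<in> carrier R. y \<ominus> \<sigma> y = t} \<subseteq> {a \<in> carrier R. c \<otimes> a \<ominus> \<sigma> (c \<otimes> a) = t}"
        using cU 1 by (auto simp del: cnj_mult)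
    qed
    from bij_betw_same_card[OF this] have "card {a \<in> carrier R. c \<otimes> a \<ominus> \<sigma> (c \<otimes> a) = t} = q"
      using card_minus_cnj_eq[OF w t st] by simp
    then show ?thesis
      using count False by (simp add: quotient_count_def AB heis_one centre_mem c_def indicator_def)
  qed
qed

lemma heis_quotient_centre:
  assumes "(A, B) \<in> carrier heis" "(\<zero>, z) \<in> centre"
  shows "(A, B) \<otimes>\<^bsub>heis\<^esub> inv\<^bsub>heis\<^esub> (\<zero>, z) = (A, B \<ominus> z)"
proof -
  have "(\<zero>, z) \<in> carrier heis" using assms(2) centre_subset by blast
  from heis_quotient[OF assms(1) this] show ?thesis
    using assms by (simp add: centre_mem heis_carrier a_minus_def)
qed

lemma quotient_count_slice_centre:
  assumes w: "w \<in> carrier R" "w \<oplus> \<sigma> w = \<one>" and x: "x \<in> carrier heis"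
  shows "quotient_count heis (slice w) centre x = 1"
proof -
  obtain A B where AB: "x = (A, B)" by (cases x)
  have R: "A \<in> carrier R" "B \<in> carrier R" and 0: "B \<oplus> \<sigma> B \<oplus> A \<otimes> \<sigma> A = \<zero>" using x AB by (auto simp: heis_carrier)
  define z where "z = B \<oplus> A \<otimes> \<sigma> A \<otimes> w"
  have zR: "z \<in> carrier R" using R w by (simp add: z_def)
  have "(\<sigma> B \<oplus> \<sigma> A \<otimes> A \<otimes> \<sigma> w) \<oplus> z = (B \<oplus> \<sigma> B \<oplus> A \<otimes> \<sigma> A) \<ominus> A \<otimes> \<sigma> A \<oplus> A \<otimes> \<sigma> A \<otimes> (w \<oplus> \<sigma> w)"
    unfolding z_def using R w(1) cnj_closed[of A] cnj_closed[of B] cnj_closed[of w] by algebra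
  also have "\<dots> = \<zero>" using R w by (simp add: 0 a_minus_def l_neg)
  finally have "\<sigma> z = \<ominus> z" using R w zR by (simp add: z_def eq_uminus_iff)
  then have zc: "(\<zero>, z) \<in> centre" using zR by (simp add: centre_mem)
  have iff: "B \<ominus> b = \<ominus> (A \<otimes> \<sigma> A \<otimes> w) \<longleftrightarrow> b = z" if "b \<in> carrier R" for b
  proof -
    have "B \<ominus> b = \<ominus> (A \<otimes> \<sigma> A \<otimes> w) \<longleftrightarrow> B \<ominus> b \<oplus> A \<otimes> \<sigma> A \<otimes> w = \<zero>" using that R w by (intro eq_uminus_iff) auto
    also have "B \<ominus> b \<oplus> A \<otimes> \<sigma> A \<otimes> w = z \<ominus> b" unfolding z_def using that R w(1) cnj_closed[of A] by algebra
    finally show ?thesis using that zR by auto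
  qed
  have "{y \<in> centre. (A, B) \<otimes>\<^bsub>heis\<^esub> inv\<^bsub>heis\<^esub> y \<in> slice w} = {(\<zero>, z)}"
  proof (intro equalityI subsetI)
    fix y assume y: "y \<in> {y \<in> centre. (A, B) \<otimes>\<^bsub>heis\<^esub> inv\<^bsub>heis\<^esub> y \<in> slice w}"
    then obtain b where b: "y = (\<zero>, b)" "b \<in> carrier R" by (auto simp: centre_def)
    then have "(A, B \<ominus> b) \<in> slice w" using y heis_quotient_centre[of A B b] x by (simp add: AB)
    then show "y \<in> {(\<zero>, z)}" using b iff by (simp add: slice_mem)
  next
    fix y assume "y \<in> {(\<zero>, z)}"
    then show "y \<in> {y \<in> centre. (A, B) \<otimes>\<^bsub>heis\<^esub> inv\<^bsub>heis\<^esub> y \<in> slice w}"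
      using zc heis_quotient_centre[of A B z] x iff[OF zR] R by (simp add: AB slice_mem)
  qed
  then show ?thesis by (simp add: quotient_count_def AB)
qed

lemma centre_eq: "(A, B) \<in> carrier heis \<Longrightarrow> (A, B) \<in> centre \<longleftrightarrow> A = \<zero>"
proof -
  assume x: "(A, B) \<in> carrier heis"
  have "\<sigma> B = \<ominus> B" if "A = \<zero>"
    using x that by (auto simp: heis_carrier eq_uminus_iff a_comm)
  then show ?thesis using x by (auto simp: centre_mem heis_carrier)
qed

lemma quotient_count_centre_slice:
  assumes w: "w \<in> carrier R" "w \<oplus> \<sigma> w = \<one>" and x: "x \<in> carrier heis"
  shows "quotient_count heis centre (slice w) x = 1"
proof -
  interpret H: group heis by (rule group_heis)
  obtain A B where AB: "x = (A, B)" by (cases x)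
  have R: "A \<in> carrier R" "B \<in> carrier R" using x AB by (auto simp: heis_carrier)
  let ?y = "\<lambda>a. (a, \<ominus> (a \<otimes> \<sigma> a \<otimes> w))"
  have "(A, B) \<otimes>\<^bsub>heis\<^esub> inv\<^bsub>heis\<^esub> (?y a) \<in> centre \<longleftrightarrow> A = a" if a: "a \<in> carrier R" for a
  proof -
    have "?y a \<in> carrier heis" using a slice_subset[OF w] by (auto simp: slice_def)
    then have "(A, B) \<otimes>\<^bsub>heis\<^esub> inv\<^bsub>heis\<^esub> (?y a) \<in> carrier heis" using x AB by auto
    then show ?thesis
      using a R x AB quotient_slice_iff[OF w, of A B a] centre_eq by auto
  qed
  then have "{y \<in> slice w. (A, B) \<otimes>\<^bsub>heis\<^esub> inv\<^bsub>heis\<^esub> y \<in> centre} = {?y A}" using R by (auto simp: slice_def)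
  then show ?thesis by (simp add: quotient_count_def AB)
qed

lemma quotient_count_centre:
  assumes x: "x \<in> carrier heis"
  shows "quotient_count heis centre centre x = int q * indicator centre x"
proof -
  interpret H: group heis by (rule group_heis)
  obtain A B where AB: "x = (A, B)" by (cases x)
  have "(A, B) \<otimes>\<^bsub>heis\<^esub> inv\<^bsub>heis\<^esub> y \<in> centre \<longleftrightarrow> x \<in> centre" if y: "y \<in> centre" for y
  proof -
    obtain b where b: "y = (\<zero>, b)" using y by (auto simp: centre_def)
    have "(A, B) \<otimes>\<^bsub>heis\<^esub> inv\<^bsub>heis\<^esub> y \<in> carrier heis" using x AB y centre_subset by auto
    then show ?thesis using heis_quotient_centre[of A B b] x y b centre_eq AB by auto
  qed
  then have "{y \<in> centre. (A, B) \<otimes>\<^bsub>heis\<^esub> inv\<^bsub>heis\<^esub> y \<in> centre} = (if x \<in> centre then centre else {})" by auto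
  moreover have "card centre = q"
  proof -
    have "centre = Pair \<zero> ` {z \<in> carrier R. \<sigma> z = \<ominus> z}" by (auto simp: centre_def)
    then show ?thesis by (simp add: card_image inj_on_def card_trace_zero)
  qed
  ultimately show ?thesis by (simp add: quotient_count_def AB)
qed

section \<open>The partial difference set in the Heisenberg group\<close>

definition unity_group :: "nat \<Rightarrow> 'a monoid" where
  "unity_group m = \<lparr>carrier = {u \<in> carrier R. u [^] m = \<one>}, monoid.mult = (\<otimes>), one = \<one>\<rparr>"

lemma cnj_nat_pow: "u \<in> carrier R \<Longrightarrow> \<sigma> u [^] (k::nat) = \<sigma> (u [^] k)"
  unfolding cnj_def by (simp only: nat_pow_pow mult.commute)

lemma group_unity_group: 
  assumes m: "m dvd q + 1" 
  shows "group (unity_group m)"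
proof (rule groupI)
  fix u assume "u \<in> carrier (unity_group m)"
  then have u: "u \<in> carrier R" "u [^] m = \<one>" by (auto simp: unity_group_def)
  have "\<sigma> u \<otimes> u = \<one>" using roots_of_unity_cnj[OF m u] u by (simp add: m_comm)
  moreover have "\<sigma> u [^] m = \<one>" using u by (simp add: cnj_nat_pow)
  ultimately show "\<exists>y\<in>carrier (unity_group m). y \<otimes>\<^bsub>unity_group m\<^esub> u = \<one>\<^bsub>unity_group m\<^esub>"
    using u by (intro bexI[of _ "\<sigma> u"]) (auto simp: unity_group_def)
qed (auto simp: unity_group_def nat_pow_distrib m_assoc)

theorem partial_difference_set_heis:
  assumes m: "m dvd q + 1" "2 \<le> m" "m < q"
  shows "\<exists>S. partial_difference_set heis S (int q ^ 3)
    ((int q - 1) * ((int q + 1) * (int m - 1) + 1))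
    ((int m - 1) * ((int q + 1) * (int m - 1) + 1) + 2 * int q - int q * int m - 2 * int m)
    ((int m - 1) * ((int q + 1) * (int m - 1) + 1))"
proof -
  interpret H: group heis by (rule group_heis)
  interpret U: group "unity_group m" by (rule group_unity_group[OF m(1)])
  let ?M = "carrier (unity_group m) - {\<one>\<^bsub>unity_group m\<^esub>}"
  have Umult: "u \<otimes>\<^bsub>unity_group m\<^esub> v = u \<otimes> v" "\<one>\<^bsub>unity_group m\<^esub> = \<one>" for u v by (auto simp: unity_group_def)
  have M: "u \<in> carrier R" "u \<otimes> \<sigma> u = \<one>" "u \<noteq> \<one>" if "u \<in> ?M" for u
    using that roots_of_unity_cnj[OF m(1)] by (auto simp: unity_group_def)
  have w: "slope u \<in> carrier R" "slope u \<oplus> \<sigma> (slope u) = \<one>" if "u \<in> ?M" for u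
    using slope_closed slope_trace M[OF that] by auto
  have ordU: "order (unity_group m) = m"
    using card_roots_of_unity[OF m(1)] by (simp add: order_def unity_group_def)
  have finU: "finite (carrier (unity_group m))" using fin by (simp add: unity_group_def)
  have "card ?M = m - 1" using ordU finU by (simp add: order_def)
  then have "?M \<noteq> {}" using m(2) by (intro notI) simp
  then obtain u0 where u0: "u0 \<in> ?M" by blast
  have Uinv: "inv\<^bsub>unity_group m\<^esub> u = \<sigma> u" if u: "u \<in> ?M" for u
  proof (rule U.inv_equality)
    show "\<sigma> u \<otimes>\<^bsub>unity_group m\<^esub> u = \<one>\<^bsub>unity_group m\<^esub>" using M[OF u] by (simp add: Umult m_comm)
    show "\<sigma> u \<in> carrier (unity_group m)" using u by (auto simp: unity_group_def cnj_nat_pow)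
  qed (use u in auto)
  show ?thesis
  proof (rule exI, rule pds_of_multiplicative_family[where U = "unity_group m" and Y = "\<lambda>u. slice (slope u)" and Z = centre])
    show "group heis" "finite (carrier heis)" by (rule group_heis, rule finite_heis)
    show "order heis = q ^ 3" using card_heis w[OF u0] by blast
    show "group (unity_group m)" by (rule group_unity_group[OF m(1)])
    show "slice (slope u) \<subseteq> carrier heis" if "u \<in> ?M" for u using slice_subset[OF w[OF that]] .
    show "\<one>\<^bsub>heis\<^esub> \<in> slice (slope u)" if "u \<in> ?M" for u using w[OF that] by (simp add: heis_one slice_mem)
    show "\<one>\<^bsub>heis\<^esub> \<in> centre" by (simp add: heis_one centre_mem)
    show "slice (slope u) \<inter> slice (slope v) = {\<one>\<^bsub>heis\<^esub>}" if uv: "u \<in> ?M" "v \<in> ?M" "u \<noteq> v" for u v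
    proof -
      have "a = \<zero>" if a: "a \<in> carrier R" "\<ominus> (a \<otimes> \<sigma> a \<otimes> slope u) = \<ominus> (a \<otimes> \<sigma> a \<otimes> slope v)" for a
      proof (rule ccontr)
        assume "a \<noteq> \<zero>"
        then have "a \<otimes> \<sigma> a \<noteq> \<zero>" using a by (metis cnj_closed cnj_cnj cnj_zero integral_iff)
        moreover have "a \<otimes> \<sigma> a \<otimes> slope u = a \<otimes> \<sigma> a \<otimes> slope v"
          using a w[OF uv(1)] w[OF uv(2)] by (metis cnj_closed m_closed minus_minus)
        ultimately have "slope u = slope v" using a w[OF uv(1)] w[OF uv(2)] by (subst (asm) m_lcancel) auto
        then show False using slope_inj M[OF uv(1)] M[OF uv(2)] uv(3) by blast
      qed
      then have "y = \<one>\<^bsub>heis\<^esub>" if "y \<in> slice (slope u)" "y \<in> slice (slope v)" for y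
        using that w[OF uv(1)] by (cases y) (force simp: slice_mem heis_one)
      moreover have "\<one>\<^bsub>heis\<^esub> \<in> slice (slope u)" "\<one>\<^bsub>heis\<^esub> \<in> slice (slope v)"
        using w[OF uv(1)] w[OF uv(2)] by (simp_all add: heis_one slice_mem)
      ultimately show ?thesis by blast
    qed
    show "slice (slope u) \<inter> centre = {\<one>\<^bsub>heis\<^esub>}" if "u \<in> ?M" for u
      using w[OF that] by (auto simp: slice_def centre_def heis_one)
    show "inv\<^bsub>heis\<^esub> y \<in> slice (slope (inv\<^bsub>unity_group m\<^esub> u))" if u: "u \<in> ?M" and y: "y \<in> slice (slope u)" for u y
    proof -
      obtain a where a: "a \<in> carrier R" "y = (a, \<ominus> (a \<otimes> \<sigma> a \<otimes> slope u))" using y by (auto simp: slice_def)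
      have "y \<in> carrier heis" using y slice_subset[OF w[OF u]] by blast
      then have "inv\<^bsub>heis\<^esub> y = (\<ominus> a, \<ominus> (\<sigma> a \<otimes> a \<otimes> \<sigma> (slope u)))"
        using a w[OF u] by (simp add: heis_inv)
      then show ?thesis
        using a w[OF u] by (simp add: Uinv[OF u] slope_cnj[OF M[OF u]] slice_mem l_minus r_minus m_comm)
    qed
    show "inv\<^bsub>heis\<^esub> z \<in> centre" if z: "z \<in> centre" for z
    proof -
      have "z \<in> carrier heis" using z centre_subset by blast
      then show ?thesis using z by (auto simp: centre_def heis_inv)
    qed
    fix x assume x: "x \<in> carrier heis"
    show "quotient_count heis centre centre x = int q * indicator centre x" by (rule quotient_count_centre[OF x])
    fix u assume u: "u \<in> ?M"
    show "quotient_count heis (slice (slope u)) centre x = 1" "quotient_count heis centre (slice (slope u)) x = 1"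
      using quotient_count_slice_centre quotient_count_centre_slice w[OF u] x by blast+
    fix v assume v: "v \<in> ?M"
    have d: "\<one> \<ominus> slope v \<ominus> slope u = \<one> \<ominus> slope u \<ominus> slope v" using w(1)[OF u] w(1)[OF v] by algebra
    {
      assume "u \<otimes>\<^bsub>unity_group m\<^esub> v \<noteq> \<one>\<^bsub>unity_group m\<^esub>"
      then have uv: "u \<otimes> v \<noteq> \<one>" by (simp add: Umult)
      have n: "u \<otimes>\<^bsub>unity_group m\<^esub> v \<in> ?M" using u v uv by (auto simp: Umult intro: U.m_closed[unfolded Umult])
      show "quotient_count heis (slice (slope u)) (slice (slope v)) x =
          int q + 1 - int q * indicator (slice (slope (u \<otimes>\<^bsub>unity_group m\<^esub> v))) x"
        using slope_mult_nontrivial[OF M[OF u] M[OF v] uv] w[OF u] w[OF v] w(1)[OF n]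
        by (intro quotient_count_slices x) (simp_all add: d Umult m_comm)
    }
    assume "u \<otimes>\<^bsub>unity_group m\<^esub> v = \<one>\<^bsub>unity_group m\<^esub>"
    then have uv: "u \<otimes> v = \<one>" by (simp add: Umult)
    show "quotient_count heis (slice (slope u)) (slice (slope v)) x =
        int q ^ 2 * indicator {\<one>\<^bsub>heis\<^esub>} x + int q * (1 - indicator centre x)"
      using slope_mult_trivial[OF M[OF u] M[OF v] uv] w[OF u] w[OF v] slope_nonzero[OF M[OF u]]
      by (intro quotient_count_complementary_slices x) (simp_all add: d)
  qed (use m ordU finU centre_subset in auto)
qed

end

section \<open>Genuinely nonabelian partial difference sets\<close>

theorem theorem4p11:
  fixes q r :: nat
  assumes "primepow q"
    and "1 < r" and "r < q + 1" and "r dvd q + 1"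
  shows "\<exists>(G :: nat monoid) S.
    partial_difference_set G S
      (int q ^ 3)
      ((int q - 1) * ((int q + 1)\<^sup>2 div int r - int q))
      (int r * ((int q + 1) div int r - 1) ^ 3 + int r - 3)
      (((int q + 1) div int r - 1) * ((int q + 1)\<^sup>2 div int r - int q))
    \<and> genuinely_nonabelian G S"
proof -
  obtain p n where pn: "normalization_semidom_class.prime p" "n > 0" "q = p ^ n"
    using assms(1) by (auto simp: primepow_def)
  have q1: "q > 1" using primepow_gt_Suc_0[OF assms(1)] by simp
  obtain m where rm: "q + 1 = r * m" using assms(4) by (auto simp: dvd_def)
  have m2: "2 \<le> m"
  proof (rule ccontr)
    assume "\<not> 2 \<le> m"
    then have "m = 0 \<or> m = 1" by auto
    then show False using rm assms(3) by auto
  qed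
  have "2 * m \<le> q + 1" unfolding rm using assms(2) by simp
  then have mq: "m < q" using m2 by simp
  have "2 * n > 0" using pn by simp
  from finite_field_exists[OF pn(1) this] obtain K :: "complex set ring"
    where K: "field K" "finite (carrier K)" "order K = p ^ (2 * n)"
    and frob: "\<And>j x y. x \<in> carrier K \<Longrightarrow> y \<in> carrier K \<Longrightarrow>
      (x \<oplus>\<^bsub>K\<^esub> y) [^]\<^bsub>K\<^esub> (p ^ j) = x [^]\<^bsub>K\<^esub> (p ^ j) \<oplus>\<^bsub>K\<^esub> y [^]\<^bsub>K\<^esub> (p ^ j)" by blast
  interpret K: field K by (rule K)
  interpret quadratic_field K q
    by unfold_locales (use K q1 frob[of _ _ n] in \<open>auto simp: pn(3) power_mult[symmetric] mult.commute\<close>)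
  have "m dvd q + 1" using rm by simp
  from partial_difference_set_heis[OF this m2 mq] partial_difference_set_nat
  obtain G :: "nat monoid" and S where pds: "partial_difference_set G S (int q ^ 3)
    ((int q - 1) * ((int q + 1) * (int m - 1) + 1))
    ((int m - 1) * ((int q + 1) * (int m - 1) + 1) + 2 * int q - int q * int m - 2 * int m)
    ((int m - 1) * ((int q + 1) * (int m - 1) + 1))" (is "partial_difference_set G S ?v ?k ?lam ?mu") by blast
  have q: "int q = int r * int m - 1" using rm by (metis add_diff_cancel_right' of_nat_1 of_nat_add of_nat_mult)
  have r0: "int r \<noteq> 0" using assms(2) by simp
  have d1: "(int q + 1) div int r = int m" using r0 by (simp add: q)
  have "(int q + 1)\<^sup>2 = int r * ((int q + 1) * int m)" by (simp add: q power2_eq_square)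
  then have d2: "(int q + 1)\<^sup>2 div int r = (int q + 1) * int m" using r0 by simp
  have k: "?k = (int q - 1) * ((int q + 1)\<^sup>2 div int r - int q)" unfolding d2 by (simp add: algebra_simps)
  have mu: "?mu = ((int q + 1) div int r - 1) * ((int q + 1)\<^sup>2 div int r - int q)" unfolding d1 d2 by (simp add: algebra_simps)
  have lam: "?lam = int r * ((int q + 1) div int r - 1) ^ 3 + int r - 3"
    unfolding d1 q by (simp add: algebra_simps power3_eq_cube power2_eq_square)
  \<comment> \<open>Modulo \<open>m\<close> one has \<open>q = - 1\<close>, \<open>k - \<mu> = - 1\<close> and \<open>\<lambda> - \<mu> = - 2\<close>.\<close>
  obtain l where l: "normalization_semidom_class.prime l" "l dvd m" using m2 prime_factor_nat[of m] by auto
  have lq: "\<not> l dvd q"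
  proof
    assume "l dvd q"
    moreover have "l dvd q + 1" using l(2) rm by simp
    ultimately have "l dvd 1" using dvd_add_right_iff by blast
    then show False using l(1) by simp
  qed
  have "genuinely_nonabelian G S"
  proof (rule pds_genuinely_nonabelian[OF pds _ l(1)])
    show "\<not> int l dvd int q ^ 3" using lq l(1) by (metis int_dvd_int_iff of_nat_power prime_dvd_power)
    have lm: "int l dvd int m" using l(2) by simp
    have "?k - ?mu + 1 = int m * ((int r - 1) * ((int q + 1) * (int m - 1) + 1) - int r * (int m - 1))"
      unfolding q by (simp add: algebra_simps)
    then show "int l dvd ?k - ?mu + 1" using lm by (metis dvd_mult2)
    have "?lam - ?mu + 2 = int m * (2 * int r - int r * int m - 1)"
      unfolding q by (simp add: algebra_simps)
    then show "int l dvd ?lam - ?mu + 2" using lm by (metis dvd_mult2)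
    \<comment> \<open>The complete graph, with \<open>k = q\<^sup>3 - 1\<close>, would correspond to \<open>m = q + 1\<close>.\<close>
    have less: "(int q + 1) * (int m - 1) < (int q + 1) * int q"
      using mq by (intro mult_strict_left_mono) auto
    have "(int q - 1) * ((int q + 1) * (int m - 1) + 1) < (int q - 1) * ((int q + 1) * int q + 1)"
      by (rule mult_strict_left_mono[OF add_strict_right_mono[OF less]]) (use q1 in simp)
    also have "\<dots> = int q ^ 3 - 1" by (simp add: algebra_simps power3_eq_cube)
    finally show "?k + 1 < int q ^ 3" by simp
  qed
  then show ?thesis using pds[unfolded lam, unfolded k mu] by blast
qed

end
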